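(* Let $m,n\ge 1$ be integers. Then $$\Omega^\perp(2;m,n)\ \ge\ \min\Big\{\rho(2;\mathbb{R},n),\ \Big\lfloor\frac{n-1}{m-1}\Big\rfloor\Big\},$$ where for $m=1$ the second term is read as $+\infty$.
   Context: A mass distribution on $\mathbb{R}^n$ is a finite (nonnegative) measure that is absolutely continuous with respect to Lebesgue measure. A hyperplane $H\subset\mathbb{R}^n$ equipartitions (bisects) a mass distribution $\mu$ if each of the two closed half-spaces bounded by $H$ has measure $\frac12\mu(\mathbb{R}^n)$. Hyperplanes are pairwise orthogonal if their normal lines are pairwise orthogonal. $\Omega^\perp(2;m,n)$ denotes the maximum $k\ge 0$ such that for any $m$ mass distributions $\mu_1,\dots,\mu_m$ on $\mathbb{R}^n$ there exist $k$ pairwise orthogonal hyperplanes in $\mathbb{R}^n$ each of which equipartitions each $\mu_j$. $V_k(\mathbb{R}^n)$ is the Stiefel manifold of orthonormal $k$-tuples $(v_1,\dots,v_k)$ in $\mathbb{R}^n$, with the free $\mathbb{Z}_2$-action $-1\cdot(v_1,\dots,v_k)=(-v_1,\dots,-v_k)$. The projection $(v_1,\dots,v_k)\mapsto v_1$ onto $S^{n-1}$ induces a fiber bundle $V_{k-1}(\mathbb{R}^{n-1})\hookrightarrow V_k(\mathbb{R}^n)/\mathbb{Z}_2\to\mathbb{R}P^{n-1}$. $\rho(2;\mathbb{R},n)$ denotes the maximum $k$ for which this bundle admits a section; equivalently, the maximum $k$ for which there is a continuous map $s:S^{n-1}\to V_k(\mathbb{R}^n)$, $s(x)=(s_1(x),\dots,s_k(x))$,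 with $s_1(x)=x$ and $s(-x)=-s(x)$ for all $x\in S^{n-1}$. *)

theory Defs
  imports "HOL-Analysis.Analysis"
begin

definition mass_distribution :: "(real ^ 'n) measure \<Rightarrow> bool" where
  "mass_distribution M \<longleftrightarrow>
     finite_measure M \<and> sets M = sets borel \<and> absolutely_continuous lborel M"

definition normal_to :: "real ^ 'n \<Rightarrow> (real ^ 'n) set \<Rightarrow> bool" where
  "normal_to a H \<longleftrightarrow> a \<noteq> 0 \<and> (\<exists>b. H = {x. a \<bullet> x = b})"

definition hyperplane :: "(real ^ 'n) set \<Rightarrow> bool" where
  "hyperplane H \<longleftrightarrow> (\<exists>a. normal_to a H)"

definition orthogonal_hyperplanes :: "(real ^ 'n) set \<Rightarrow> (real ^ 'n) set \<Rightarrow> bool" where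
  "orthogonal_hyperplanes H H' \<longleftrightarrow>
     (\<exists>a a'. normal_to a H \<and> normal_to a' H' \<and> orthogonal a a')"

definition equipartitions :: "(real ^ 'n) set \<Rightarrow> (real ^ 'n) measure \<Rightarrow> bool" where
  "equipartitions H M \<longleftrightarrow>
     (\<exists>a b. a \<noteq> 0 \<and> H = {x. a \<bullet> x = b} \<and>
        measure M {x. a \<bullet> x \<le> b} = measure M UNIV / 2 \<and>
        measure M {x. a \<bullet> x \<ge> b} = measure M UNIV / 2)"

definition orthogonally_equipartitionable :: "'n::finite itself \<Rightarrow> nat \<Rightarrow> nat \<Rightarrow> bool" where
  "orthogonally_equipartitionable _ m k \<longleftrightarrow>
     (\<forall>\<mu> :: nat \<Rightarrow> (real ^ 'n) measure. (\<forall>j<m. mass_distribution (\<mu> j)) \<longrightarrow>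
        (\<exists>H :: nat \<Rightarrow> (real ^ 'n) set.
           (\<forall>i<k. hyperplane (H i)) \<and>
           (\<forall>i<k. \<forall>i'<k. i \<noteq> i' \<longrightarrow> orthogonal_hyperplanes (H i) (H i')) \<and>
           (\<forall>i<k. \<forall>j<m. equipartitions (H i) (\<mu> j))))"

text \<open>This is \<open>\<Omega>\<^sup>\<bottom>(2;m,n)\<close> for \<open>n = CARD('n)\<close>. By \<open>Omega_perp_attained\<close> below, the
  maximum exists.\<close>

definition Omega_perp :: "'n::finite itself \<Rightarrow> nat \<Rightarrow> nat" where
  "Omega_perp T m = Max {k. orthogonally_equipartitionable T m k}"

text \<open>A \<open>k\<close>-frame is an extensional function on \<open>{..<k}\<close>; its first entry has index \<open>0\<close>.\<close>

definition stiefel :: "nat \<Rightarrow> (nat \<Rightarrow> real ^ 'n) set" where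
  "stiefel k = {v \<in> {..<k} \<rightarrow>\<^sub>E UNIV. \<forall>i<k. \<forall>j<k. v i \<bullet> v j = (if i = j then 1 else 0)}"

definition stiefel_top :: "nat \<Rightarrow> (nat \<Rightarrow> real ^ 'n) topology" where
  "stiefel_top k = subtopology (product_topology (\<lambda>_. euclidean) {..<k}) (stiefel k)"

definition neg_frame :: "nat \<Rightarrow> (nat \<Rightarrow> real ^ 'n) \<Rightarrow> (nat \<Rightarrow> real ^ 'n)" where
  "neg_frame k v = (\<lambda>i\<in>{..<k}. - v i)"

text \<open>The quotient topology on the image of \<open>q\<close>; see \<open>quotient_map_quotient_space\<close> below.\<close>

definition quotient_space :: "'a topology \<Rightarrow> ('a \<Rightarrow> 'b) \<Rightarrow> 'b topology" where
  "quotient_space X q =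
     topology (\<lambda>U. U \<subseteq> q ` topspace X \<and> openin X {x \<in> topspace X. q x \<in> U})"

text \<open>Points of \<open>V\<^sub>k(\<real>\<^sup>n)/\<int>\<^sub>2\<close> and \<open>\<real>P\<^sup>n\<^sup>-\<^sup>1\<close> are antipodal orbits \<open>{v, -v}\<close>.\<close>

definition stiefel_mod_Z2 :: "nat \<Rightarrow> (nat \<Rightarrow> real ^ 'n) set topology" where
  "stiefel_mod_Z2 k = quotient_space (stiefel_top k) (\<lambda>v. {v, neg_frame k v})"

definition proj_space :: "(real ^ 'n) set topology" where
  "proj_space = quotient_space (top_of_set (sphere 0 1)) (\<lambda>x. {x, - x})"

text \<open>The map \<open>V\<^sub>k(\<real>\<^sup>n)/\<int>\<^sub>2 \<rightarrow> \<real>P\<^sup>n\<^sup>-\<^sup>1\<close>: the orbit \<open>{v, -v}\<close> goes to \<open>{v\<^sub>1, -v\<^sub>1}\<close>.\<close>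

definition bundle_proj :: "(nat \<Rightarrow> real ^ 'n) set \<Rightarrow> (real ^ 'n) set" where
  "bundle_proj W = (\<lambda>v. v 0) ` W"

definition has_bundle_section :: "'n::finite itself \<Rightarrow> nat \<Rightarrow> bool" where
  "has_bundle_section _ k \<longleftrightarrow>
     (\<exists>\<sigma> :: (real ^ 'n) set \<Rightarrow> (nat \<Rightarrow> real ^ 'n) set.
        continuous_map proj_space (stiefel_mod_Z2 k) \<sigma> \<and>
        (\<forall>L \<in> topspace proj_space. bundle_proj (\<sigma> L) = L))"

text \<open>This is \<open>\<rho>(2;\<real>,n)\<close> for \<open>n = CARD('n)\<close>. The bundle is defined for \<open>k \<ge> 1\<close> only. By
  \<open>rho_attained\<close> below, the maximum exists.\<close>

definition rho :: "'n::finite itself \<Rightarrow> nat" where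
  "rho T = Max {k. 1 \<le> k \<and> has_bundle_section T k}"

lemma orthogonal_family_bound:
  fixes a :: "nat \<Rightarrow> real ^ 'n"
  assumes nz: "\<And>i. i < k \<Longrightarrow> a i \<noteq> 0"
    and orth: "\<And>i j. i < k \<Longrightarrow> j < k \<Longrightarrow> i \<noteq> j \<Longrightarrow> a i \<bullet> a j = 0"
  shows "k \<le> CARD('n)"
proof -
  have inj: "inj_on a {..<k}"
  proof (rule inj_onI, rule ccontr)
    fix i j assume "i \<in> {..<k}" "j \<in> {..<k}" "a i = a j" "i \<noteq> j"
    then show False using orth[of i j] nz[of i] by auto
  qed
  have "pairwise orthogonal (a ` {..<k})"
    unfolding pairwise_def orthogonal_def using orth by auto
  moreover have "0 \<notin> a ` {..<k}" using nz by force
  ultimately have "independent (a ` {..<k})" by (rule pairwise_orthogonal_independent)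
  then have "card (a ` {..<k}) \<le> DIM(real ^ 'n)" by (rule independent_bound[THEN conjunct2])
  then show ?thesis by (simp add: card_image[OF inj])
qed

lemma normal_to_parallel:
  fixes H :: "(real ^ 'n) set"
  assumes "normal_to a H" "normal_to a' H"
  shows "\<exists>c. a' = c *\<^sub>R a"
proof -
  obtain b b' where H: "H = {x. a \<bullet> x = b}" "H = {x. a' \<bullet> x = b'}" and nz: "a \<noteq> 0"
    using assms unfolding normal_to_def by auto
  define p where "p = (b / (a \<bullet> a)) *\<^sub>R a"
  have p: "p \<in> H" unfolding H(1) p_def using nz by simp
  define w where "w = a' - ((a \<bullet> a') / (a \<bullet> a)) *\<^sub>R a"
  have aw: "a \<bullet> w = 0" unfolding w_def using nz by (simp add: inner_diff_right)
  then have "p + w \<in> H" using p unfolding H(1) by (simp add: inner_add_right)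
  then have "a' \<bullet> (p + w) = b'" unfolding H(2) by simp
  then have "a' \<bullet> w = 0" using p unfolding H(2) by (simp add: inner_add_right)
  then have "w \<bullet> w = 0" using aw by (subst (1) w_def) (simp add: inner_diff_left)
  then show ?thesis unfolding w_def by auto
qed

lemma orthogonal_hyperplanesD:
  assumes "orthogonal_hyperplanes H H'" "normal_to a H" "normal_to a' H'"
  shows "orthogonal a a'"
proof -
  obtain c c' where c: "normal_to c H" "normal_to c' H'" "orthogonal c c'"
    using assms(1) unfolding orthogonal_hyperplanes_def by auto
  obtain r r' where "a = r *\<^sub>R c" "a' = r' *\<^sub>R c'"
    using normal_to_parallel[OF c(1) assms(2)] normal_to_parallel[OF c(2) assms(3)] by auto
  then show ?thesis using c(3) by (simp add: orthogonal_clauses)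
qed

lemma orthogonally_equipartitionable_le:
  assumes "orthogonally_equipartitionable TYPE('n::finite) m k"
  shows "k \<le> CARD('n)"
proof -
  have "mass_distribution (null_measure borel :: (real ^ 'n) measure)"
    unfolding mass_distribution_def absolutely_continuous_def null_sets_def
    by (auto intro!: finite_measureI)
  then obtain H :: "nat \<Rightarrow> (real ^ 'n) set" where
    H: "\<And>i. i < k \<Longrightarrow> hyperplane (H i)"
       "\<And>i i'. i < k \<Longrightarrow> i' < k \<Longrightarrow> i \<noteq> i' \<Longrightarrow> orthogonal_hyperplanes (H i) (H i')"
    using assms[unfolded orthogonally_equipartitionable_def,
        rule_format, of "\<lambda>_. null_measure borel"] by blast
  obtain a where a: "\<And>i. i < k \<Longrightarrow> normal_to (a i) (H i)"
    using H(1) unfolding hyperplane_def by metis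
  show ?thesis
  proof (rule orthogonal_family_bound[of k a])
    show "a i \<noteq> 0" if "i < k" for i using a[OF that] by (simp add: normal_to_def)
    show "a i \<bullet> a j = 0" if "i < k" "j < k" "i \<noteq> j" for i j
      using orthogonal_hyperplanesD[OF H(2)[OF that] a[OF that(1)] a[OF that(2)]]
      by (simp add: orthogonal_def)
  qed
qed

lemma orthogonally_equipartitionable_0: "orthogonally_equipartitionable T m 0"
  by (simp add: orthogonally_equipartitionable_def)

lemma Omega_perp_attained:
  "finite {k. orthogonally_equipartitionable TYPE('n::finite) m k}"
  "orthogonally_equipartitionable TYPE('n) m (Omega_perp TYPE('n) m)"
proof -
  show fin: "finite {k. orthogonally_equipartitionable TYPE('n) m k}"
    by (rule finite_subset[of _ "{..CARD('n)}"]) (auto dest: orthogonally_equipartitionable_le)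
  have "Omega_perp TYPE('n) m \<in> {k. orthogonally_equipartitionable TYPE('n) m k}"
    unfolding Omega_perp_def using fin orthogonally_equipartitionable_0 by (intro Max_in) auto
  then show "orthogonally_equipartitionable TYPE('n) m (Omega_perp TYPE('n) m)" by simp
qed

lemma quotient_map_quotient_space: "quotient_map X (quotient_space X q) q"
proof -
  let ?P = "\<lambda>U. U \<subseteq> q ` topspace X \<and> openin X {x \<in> topspace X. q x \<in> U}"
  have "istopology ?P"
    unfolding istopology_def
  proof (rule conjI; intro allI impI)
    fix S T assume "?P S" "?P T"
    moreover have "{x \<in> topspace X. q x \<in> S \<inter> T} =
        {x \<in> topspace X. q x \<in> S} \<inter> {x \<in> topspace X. q x \<in> T}" by auto
    ultimately show "?P (S \<inter> T)" by (auto intro: openin_Int)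
  next
    fix K assume K: "\<forall>S\<in>K. ?P S"
    have "{x \<in> topspace X. q x \<in> \<Union>K} = (\<Union>S\<in>K. {x \<in> topspace X. q x \<in> S})" by auto
    then show "?P (\<Union>K)" using K by auto
  qed
  then have op: "openin (quotient_space X q) = ?P"
    unfolding quotient_space_def by (rule topology_inverse')
  have "topspace (quotient_space X q) = q ` topspace X"
  proof
    show "topspace (quotient_space X q) \<subseteq> q ` topspace X"
      using openin_topspace[of "quotient_space X q"] unfolding op by simp
    have "{x \<in> topspace X. q x \<in> q ` topspace X} = topspace X" by auto
    then have "openin (quotient_space X q) (q ` topspace X)" unfolding op by simp
    then show "q ` topspace X \<subseteq> topspace (quotient_space X q)" by (rule openin_subset)
  qed
  then show ?thesis unfolding quotient_map_def op by auto
qed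

text \<open>Sections of the bundle correspond to odd maps \<open>s : S\<^sup>n\<^sup>-\<^sup>1 \<rightarrow> V\<^sub>k(\<real>\<^sup>n)\<close> with \<open>s\<^sub>1(x) = x\<close>.\<close>

lemma topspace_stiefel_top: "topspace (stiefel_top k) = stiefel k"
  unfolding stiefel_top_def by (auto simp: stiefel_def)

lemma neg_frame_in_stiefel: "v \<in> stiefel k \<Longrightarrow> neg_frame k v \<in> stiefel k"
  by (auto simp: stiefel_def neg_frame_def)

lemma neg_neg_frame: "v \<in> stiefel k \<Longrightarrow> neg_frame k (neg_frame k v) = v"
  unfolding stiefel_def neg_frame_def by (auto simp: PiE_def extensional_def)

lemma continuous_map_neg_frame: "continuous_map (stiefel_top k) (stiefel_top k) (neg_frame k)"
proof -
  have "continuous_map (stiefel_top k) euclidean (\<lambda>v. - v i)" if "i < k" for i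
  proof -
    have "continuous_map (stiefel_top k) euclidean (\<lambda>v. v i)"
      unfolding stiefel_top_def
      using that by (intro continuous_map_from_subtopology continuous_map_product_projection) auto
    then show ?thesis by (rule continuous_map_minus)
  qed
  then have "continuous_map (stiefel_top k) (product_topology (\<lambda>_. euclidean) {..<k}) (neg_frame k)"
    unfolding continuous_map_componentwise by (auto simp: neg_frame_def)
  then show ?thesis
    using neg_frame_in_stiefel unfolding stiefel_top_def continuous_map_in_subtopology
    by (fastforce simp flip: topspace_stiefel_top stiefel_top_def)
qed

lemma has_bundle_section_iff_odd_map:
  fixes k :: nat
  assumes k: "1 \<le> k"
  shows "has_bundle_section TYPE('n::finite) k \<longleftrightarrow>
    (\<exists>s :: real ^ 'n \<Rightarrow> (nat \<Rightarrow> real ^ 'n).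
       continuous_map (top_of_set (sphere 0 1)) (stiefel_top k) s \<and>
       (\<forall>x \<in> sphere 0 1. s x 0 = x \<and> s (- x) = neg_frame k (s x)))"
proof -
  let ?S = "top_of_set (sphere 0 1) :: (real ^ 'n) topology"
  let ?p = "\<lambda>x :: real ^ 'n. {x, - x}"
  let ?q = "\<lambda>v :: nat \<Rightarrow> real ^ 'n. {v, neg_frame k v}"
  have p: "quotient_map ?S proj_space ?p"
    unfolding proj_space_def by (rule quotient_map_quotient_space)
  have q: "quotient_map (stiefel_top k) (stiefel_mod_Z2 k) ?q"
    unfolding stiefel_mod_Z2_def by (rule quotient_map_quotient_space)
  have tp: "topspace proj_space = ?p ` sphere 0 1"
    using quotient_imp_surjective_map[OF p] by simp
  have tq: "topspace (stiefel_mod_Z2 k) = ?q ` stiefel k"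
    using quotient_imp_surjective_map[OF q] by (simp add: topspace_stiefel_top)
  have nf0: "neg_frame k v 0 = - v 0" for v :: "nat \<Rightarrow> real ^ 'n"
    using k by (simp add: neg_frame_def)
  show ?thesis
  proof
    assume "has_bundle_section TYPE('n) k"
    then obtain \<sigma> :: "(real ^ 'n) set \<Rightarrow> (nat \<Rightarrow> real ^ 'n) set"
      where \<sigma>: "continuous_map proj_space (stiefel_mod_Z2 k) \<sigma>"
      and sec: "\<And>L. L \<in> topspace proj_space \<Longrightarrow> bundle_proj (\<sigma> L) = L"
      unfolding has_bundle_section_def by blast
    have ex: "\<exists>v \<in> stiefel k. \<sigma> {x, - x} = ?q v \<and> v 0 = x" if x: "x \<in> sphere 0 1" for x
    proof -
      have L: "{x, - x} \<in> topspace proj_space" using x tp by auto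
      then have "\<sigma> {x, - x} \<in> ?q ` stiefel k"
        using \<sigma> tq unfolding continuous_map_def by blast
      then obtain w where w: "w \<in> stiefel k" "\<sigma> {x, - x} = ?q w" by auto
      have "{w 0, - w 0} = {x, - x}" using sec[OF L] w(2) nf0 by (simp add: bundle_proj_def)
      then have "w 0 = x \<or> w 0 = - x" by auto
      then show ?thesis
      proof
        assume "w 0 = x" then show ?thesis using w by auto
      next
        assume "w 0 = - x"
        then show ?thesis using w neg_frame_in_stiefel[OF w(1)] nf0
          by (intro bexI[of _ "neg_frame k w"]) (auto simp: neg_neg_frame)
      qed
    qed
    then obtain s where s: "\<And>x. x \<in> sphere 0 1 \<Longrightarrow> s x \<in> stiefel k"
      "\<And>x. x \<in> sphere 0 1 \<Longrightarrow> \<sigma> {x, - x} = ?q (s x)"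
      "\<And>x. x \<in> sphere 0 1 \<Longrightarrow> s x 0 = x"
      by metis
    have odd: "s (- x) = neg_frame k (s x)" if x: "x \<in> sphere 0 1" for x
    proof -
      have mx: "- x \<in> sphere 0 1" using x by auto
      have nx: "x \<noteq> - x"
      proof
        assume "x = - x"
        then have "x \<bullet> x = - (x \<bullet> x)" by (metis inner_minus_right)
        then show False using x by (simp add: dot_square_norm)
      qed
      have "?q (s (- x)) = ?q (s x)" using s(2)[OF x] s(2)[OF mx] by (simp add: insert_commute)
      then have "s (- x) = s x \<or> s (- x) = neg_frame k (s x)" by auto
      then show ?thesis using s(3)[OF x] s(3)[OF mx] nx by metis
    qed
    have cont_\<sigma>p: "continuous_map ?S (stiefel_mod_Z2 k) (\<sigma> \<circ> ?p)"
      using quotient_imp_continuous_map[OF p] \<sigma> by (rule continuous_map_compose)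
    have cont0: "continuous_map (stiefel_top k) euclidean (\<lambda>v :: nat \<Rightarrow> real ^ 'n. v 0)"
      unfolding stiefel_top_def
      using k by (intro continuous_map_from_subtopology continuous_map_product_projection) auto
    have "continuous_map ?S (stiefel_top k) s"
      unfolding continuous_map_eq_topcontinuous_at topcontinuous_at_def
    proof (intro ballI conjI allI impI Pi_I)
      fix x assume "x \<in> topspace ?S"
      then have x: "x \<in> sphere 0 1" by simp
      show "x \<in> topspace ?S" using x by simp
      show "s y \<in> topspace (stiefel_top k)" if "y \<in> topspace ?S" for y
        using that s(1) by (simp add: topspace_stiefel_top)
      fix V assume V: "openin (stiefel_top k) V \<and> s x \<in> V"
      define V' where "V' = V \<inter> {v \<in> topspace (stiefel_top k). v 0 \<in> {y. x \<bullet> y > 0}}"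
      have "openin (stiefel_top k) {v \<in> topspace (stiefel_top k). v 0 \<in> {y. x \<bullet> y > 0}}"
        by (rule openin_continuous_map_preimage[OF cont0]) (simp add: open_halfspace_gt)
      then have V': "openin (stiefel_top k) V'" using V unfolding V'_def by blast
      then have V'sub: "V' \<subseteq> stiefel k" using openin_subset topspace_stiefel_top by metis
      have sxV': "s x \<in> V'"
        using V x s unfolding V'_def by (auto simp: topspace_stiefel_top dot_square_norm)
      have "{v \<in> topspace (stiefel_top k). ?q v \<in> ?q ` V'} =
          V' \<union> {v \<in> topspace (stiefel_top k). neg_frame k v \<in> V'}"
        using V'sub
        by (auto simp: topspace_stiefel_top doubleton_eq_iff neg_neg_frame image_iff)
          (metis neg_neg_frame)
      moreover have "openin (stiefel_top k) {v \<in> topspace (stiefel_top k). neg_frame k v \<in> V'}"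
        by (rule openin_continuous_map_preimage[OF continuous_map_neg_frame V'])
      ultimately have "openin (stiefel_top k) {v \<in> topspace (stiefel_top k). ?q v \<in> ?q ` V'}"
        using V' by auto
      moreover have "?q ` V' \<subseteq> topspace (stiefel_mod_Z2 k)" using V'sub tq by auto
      ultimately have "openin (stiefel_mod_Z2 k) (?q ` V')"
        using q unfolding quotient_map_def by blast
      then have "openin ?S {y \<in> topspace ?S. (\<sigma> \<circ> ?p) y \<in> ?q ` V'}"
        by (rule openin_continuous_map_preimage[OF cont_\<sigma>p])
      moreover have "openin ?S (sphere 0 1 \<inter> {y. x \<bullet> y > 0})"
        by (rule openin_open_Int) (rule open_halfspace_gt)
      ultimately have
        "openin ?S ({y \<in> topspace ?S. (\<sigma> \<circ> ?p) y \<in> ?q ` V'} \<inter> (sphere 0 1 \<inter> {y. x \<bullet> y > 0}))"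
        (is "openin _ ?U") by (rule openin_Int)
      moreover have "x \<in> ?U" using x sxV' s(2) by (auto simp: dot_square_norm)
      moreover have "s y \<in> V" if "y \<in> ?U" for y
      proof -
        have y: "y \<in> sphere 0 1" "x \<bullet> y > 0" using that by auto
        have "\<sigma> {y, - y} \<in> ?q ` V'" using that by auto
        then have "?q (s y) \<in> ?q ` V'" unfolding s(2)[OF y(1)] .
        then obtain v where v: "v \<in> V'" "?q (s y) = ?q v" by blast
        then have "s y = v \<or> s y = neg_frame k v" by auto
        moreover have "s y \<noteq> neg_frame k v"
        proof
          assume "s y = neg_frame k v"
          then have "y = - v 0" using s(3)[OF y(1)] nf0 by metis
          then show False using y(2) v(1) unfolding V'_def by auto
        qed
        ultimately show ?thesis using v(1) unfolding V'_def by auto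
      qed
      ultimately show "\<exists>U. openin ?S U \<and> x \<in> U \<and> (\<forall>y\<in>U. s y \<in> V)" by blast
    qed
    then show "\<exists>s. continuous_map ?S (stiefel_top k) s \<and>
        (\<forall>x \<in> sphere 0 1. s x 0 = x \<and> s (- x) = neg_frame k (s x))"
      using s(3) odd by blast
  next
    assume "\<exists>s. continuous_map ?S (stiefel_top k) s \<and>
        (\<forall>x \<in> sphere 0 1. s x 0 = x \<and> s (- x) = neg_frame k (s x))"
    then obtain s where s: "continuous_map ?S (stiefel_top k) s"
      and s0: "\<And>x. x \<in> sphere 0 1 \<Longrightarrow> s x 0 = x"
      and odd: "\<And>x. x \<in> sphere 0 1 \<Longrightarrow> s (- x) = neg_frame k (s x)"
      by blast
    have st: "s x \<in> stiefel k" if "x \<in> sphere 0 1" for x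
      using s that unfolding continuous_map_def topspace_stiefel_top by auto
    have im: "s ` {x, - x} = ?q (s x)" if "x \<in> sphere 0 1" for x
      using odd[OF that] by simp
    have "continuous_map ?S (stiefel_mod_Z2 k) (?q \<circ> s)"
      using s quotient_imp_continuous_map[OF q] by (rule continuous_map_compose)
    then have "continuous_map ?S (stiefel_mod_Z2 k) ((\<lambda>L. s ` L) \<circ> ?p)"
      by (rule continuous_map_eq) (simp add: odd)
    then have "continuous_map proj_space (stiefel_mod_Z2 k) (\<lambda>L. s ` L)"
      by (rule continuous_compose_quotient_map[OF p])
    moreover have "bundle_proj (s ` L) = L" if L: "L \<in> topspace proj_space" for L
    proof -
      obtain x where "x \<in> sphere 0 1" "L = {x, - x}" using L unfolding tp by blast
      then show ?thesis using s0[of x] s0[of "- x"] by (simp add: bundle_proj_def)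
    qed
    ultimately show "has_bundle_section TYPE('n) k"
      unfolding has_bundle_section_def by blast
  qed
qed

lemma has_bundle_section_le:
  assumes "has_bundle_section TYPE('n::finite) k" "1 \<le> k"
  shows "k \<le> CARD('n)"
proof -
  obtain s :: "real ^ 'n \<Rightarrow> (nat \<Rightarrow> real ^ 'n)"
    where s: "continuous_map (top_of_set (sphere 0 1)) (stiefel_top k) s"
    using assms has_bundle_section_iff_odd_map by blast
  obtain x :: "real ^ 'n" where "norm x = 1" using vector_choose_size[of 1] by auto
  then have "s x \<in> stiefel k"
    using s unfolding continuous_map_def topspace_stiefel_top by auto
  then have v: "\<And>i j. i < k \<Longrightarrow> j < k \<Longrightarrow> s x i \<bullet> s x j = (if i = j then 1 else 0)"
    by (simp add: stiefel_def)
  show ?thesis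
  proof (rule orthogonal_family_bound[of k "s x"])
    show "s x i \<noteq> 0" if "i < k" for i using v[OF that that] by auto
  qed (use v in auto)
qed

lemma has_bundle_section_1: "has_bundle_section TYPE('n::finite) 1"
proof -
  let ?s = "\<lambda>x :: real ^ 'n. \<lambda>i\<in>{..<1::nat}. x"
  have "continuous_map (top_of_set (sphere 0 1)) (product_topology (\<lambda>_. euclidean) {..<1::nat}) ?s"
    unfolding continuous_map_componentwise by auto
  moreover have "?s x \<in> stiefel 1" if "x \<in> sphere 0 1" for x
    using that by (auto simp: stiefel_def dot_square_norm)
  ultimately have "continuous_map (top_of_set (sphere 0 1)) (stiefel_top 1) ?s"
    unfolding stiefel_top_def continuous_map_in_subtopology by auto
  moreover have "\<forall>x \<in> sphere 0 1. ?s x 0 = x \<and> ?s (- x) = neg_frame 1 (?s x)"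
    by (auto simp: neg_frame_def)
  ultimately show ?thesis
    by (subst has_bundle_section_iff_odd_map) blast+
qed

lemma rho_attained:
  "finite {k. 1 \<le> k \<and> has_bundle_section TYPE('n::finite) k}"
  "1 \<le> rho TYPE('n) \<and> has_bundle_section TYPE('n) (rho TYPE('n))"
proof -
  show fin: "finite {k. 1 \<le> k \<and> has_bundle_section TYPE('n) k}"
    by (rule finite_subset[of _ "{..CARD('n)}"]) (auto dest: has_bundle_section_le)
  have "rho TYPE('n) \<in> {k. 1 \<le> k \<and> has_bundle_section TYPE('n) k}"
    unfolding rho_def using fin has_bundle_section_1 by (intro Max_in) auto
  then show "1 \<le> rho TYPE('n) \<and> has_bundle_section TYPE('n) (rho TYPE('n))" by simp
qed

end

theory Submission
  imports Defs "HOL-Homology.Invariance_of_Domain"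
begin

text \<open>
  Send a direction \<open>x\<close> on the sphere through an odd section \<open>s\<close>, and for each \<open>i < k\<close> take the
  hyperplane normal to \<open>s x i\<close> that bisects \<open>\<mu> 0\<close>. The defects of these hyperplanes on the other
  \<open>m - 1\<close> measures form an odd map from the sphere to a space of dimension
  \<open>k * (m - 1) \<le> n - 1\<close>, which has a zero by the Borsuk-Ulam theorem. A bisecting hyperplane of
  \<open>\<mu> 0\<close> need not be unique nor depend continuously on its normal, so the bisection condition is
  first tilted by a term \<open>\<epsilon> * t\<close> in the offset \<open>t\<close>, and compactness handles the limit
  \<open>\<epsilon> \<rightarrow> 0\<close>.

  The Borsuk-Ulam theorem is proved with singular chains. As the homology of the sphere vanishes
  in low positive degrees, there are chains \<open>c\<^sub>0, c\<^sub>1, \<dots>\<close> (algebraic hemispheres), starting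
  with a point, such that the boundary of \<open>c\<^sub>p\<^sub>+\<^sub>1\<close> is \<open>c\<^sub>p\<close> plus or minus its antipode; they
  may be subdivided. Label a point by the first coordinate in which the odd map is large, with its
  sign. Ky Fan's parity count of the simplices whose labels alternate in sign is invariant along
  the chains, hence odd; but in degree \<open>d\<close> there are \<open>d + 1\<close> vertices and only \<open>d\<close>
  coordinates, so a small simplex cannot alternate.
\<close>

section \<open>Alternating sign sequences\<close>

primrec alternates :: "bool \<Rightarrow> bool list \<Rightarrow> bool" where
  "alternates b [] \<longleftrightarrow> True"
| "alternates b (c # cs) \<longleftrightarrow> c = b \<and> alternates (\<not> b) cs"

lemma alternates_map_Not: "alternates b (map (\<lambda>x. \<not> s x) xs) \<longleftrightarrow> alternates (\<not> b) (map s xs)"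
  by (induction xs arbitrary: b) auto

lemma alternates_nth_Suc: "alternates b xs \<Longrightarrow> Suc j < length xs \<Longrightarrow> xs ! Suc j \<longleftrightarrow> \<not> xs ! j"
proof (induction xs arbitrary: b j)
  case (Cons c cs)
  show ?case
  proof (cases j)
    case 0
    then show ?thesis using Cons.prems by (cases cs) auto
  next
    case (Suc i)
    then show ?thesis using Cons.IH[of "\<not> b" i] Cons.prems by auto
  qed
qed simp

text \<open>
  If exactly one sign repeats its predecessor, removing either of the two gives the same sequence;
  a fully alternating sequence stays alternating only without its first or last entry.
\<close>

lemma even_alternates_remove:
  assumes "distinct xs"
  shows "even ((\<Sum>j\<in>set xs. of_bool (alternates b (map s (filter (\<lambda>i. i \<noteq> j) xs))))
    + of_bool (alternates b (map s xs)) + of_bool (alternates (\<not> b) (map s xs)) :: int)"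
  using assms
proof (induction xs arbitrary: b)
  case (Cons a xs)
  have a: "filter (\<lambda>i. i \<noteq> a) xs = xs"
    using Cons.prems by (auto simp: filter_id_conv)
  have "filter (\<lambda>i. i \<noteq> j) (a # xs) = a # filter (\<lambda>i. i \<noteq> j) xs" if "j \<in> set xs" for j
    using Cons.prems that by auto
  moreover have "sum h (set (a # xs)) = h a + sum h (set xs)" for h :: "'a \<Rightarrow> int"
    using Cons.prems by simp
  ultimately have "(\<Sum>j\<in>set (a # xs). of_bool (alternates b (map s (filter (\<lambda>i. i \<noteq> j) (a # xs)))) :: int)
      = of_bool (alternates b (map s xs)) +
        (\<Sum>j\<in>set xs. of_bool (alternates b (map s (a # filter (\<lambda>i. i \<noteq> j) xs))))"
    using a by (simp cong: sum.cong del: sum_of_bool_eq)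
  \<comment> \<open>If \<open>s a = b\<close>, the sum over \<open>xs\<close> is the one in the
    hypothesis for \<open>\<not> b\<close>, whose other two summands come from removing
    \<open>a\<close> and from the whole list. If \<open>s a \<noteq> b\<close>, that sum vanishes
    and two equal terms remain.\<close>
  then show ?case
    using Cons.IH[of "\<not> b"] Cons.prems by (cases "s a = b") auto
qed simp

text \<open>Sorting sees an entry only through its key. Thus vertices can be sorted through their
  indices, which stay distinct when vertices coincide.\<close>

lemma map_sort_key: "map g (sort_key (\<lambda>x. k (g x)) xs) = sort_key k (map g xs)"
proof -
  have "map g (insort_key (\<lambda>x. k (g x)) a ys) = insort_key k (g a) (map g ys)" for a ys
    by (induction ys) auto
  then show ?thesis by (induction xs) auto
qed

text \<open>The left side lists the vertices of the \<open>k\<close>-th face in the numbering of the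
  whole simplex.\<close>

lemma map_skip_upt:
  assumes "k \<le> n"
  shows "map (\<lambda>i. if i < k then i else Suc i) [0..<n] = filter (\<lambda>i. i \<noteq> k) [0..<Suc n]"
proof -
  have "[0..<n] = [0..<k] @ [k..<n]"
    using assms upt_add_eq_append[of 0 k "n - k"] by simp
  moreover have "[0..<Suc n] = [0..<k] @ k # [Suc k..<Suc n]"
    using assms upt_add_eq_append[of 0 k "Suc n - k"] upt_conv_Cons[of k "Suc n"] by (simp del: upt_Suc)
  moreover have "map (\<lambda>i. if i < k then i else Suc i) [k..<n] = [Suc k..<Suc n]"
    by (subst map_Suc_upt[symmetric]) (rule map_cong, auto)
  moreover have "map (\<lambda>i. if i < k then i else Suc i) [0..<k] = [0..<k]"
    by (rule map_idI) auto
  moreover have "filter (\<lambda>i. i \<noteq> k) [0..<k] = [0..<k]"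
    "filter (\<lambda>i. i \<noteq> k) [Suc k..<Suc n] = [Suc k..<Suc n]"
    by (auto simp: filter_id_conv simp del: upt_Suc)
  ultimately show ?thesis by (simp del: upt_Suc)
qed

section \<open>Counting alternating singular simplices\<close>

definition vertex :: "nat \<Rightarrow> nat \<Rightarrow> real" where
  "vertex i = (\<lambda>j. if j = i then 1 else 0)"

lemma vertex_in_standard_simplex [simp]: "vertex i \<in> standard_simplex p \<longleftrightarrow> i \<le> p"
  by (simp add: vertex_def)

lemma singular_face_vertex:
  assumes "i \<le> p"
  shows "singular_face (Suc p) k f (vertex i) = f (vertex (if i < k then i else Suc i))"
proof -
  have "simplical_face k (vertex i) = vertex (if i < k then i else Suc i)"
    by (auto simp: simplical_face_def vertex_def fun_eq_iff)
  then show ?thesis using assms by (simp add: singular_face_def)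
qed

text \<open>
  \<open>\<kappa>\<close> is the absolute value of the label of a point and \<open>s\<close> its sign. The sorting is stable and
  looks at \<open>\<kappa>\<close> only, so it commutes with the antipode and with the removal of a vertex even if
  absolute values are repeated.
\<close>

definition alternating_simplex ::
    "('a \<Rightarrow> nat) \<Rightarrow> ('a \<Rightarrow> bool) \<Rightarrow> nat \<Rightarrow> bool \<Rightarrow> ((nat \<Rightarrow> real) \<Rightarrow> 'a) \<Rightarrow> bool" where
  "alternating_simplex \<kappa> s p b f \<longleftrightarrow>
     alternates b (map s (sort_key \<kappa> (map (\<lambda>i. f (vertex i)) [0..<Suc p])))"

text \<open>This is the sum of the coefficients of the alternating simplices; passing through the
  free abelian group on one generator makes linearity an instance of the laws of
  \<open>frag_extend\<close>.\<close>

definition alternating_count ::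
    "('a \<Rightarrow> nat) \<Rightarrow> ('a \<Rightarrow> bool) \<Rightarrow> nat \<Rightarrow> bool \<Rightarrow> 'a chain \<Rightarrow> int" where
  "alternating_count \<kappa> s p b c = poly_mapping.lookup
     (frag_extend (\<lambda>f. if alternating_simplex \<kappa> s p b f then frag_of () else 0) c) ()"

lemma alternating_count_0: "alternating_count \<kappa> s p b 0 = 0"
  by (simp add: alternating_count_def)

lemma alternating_count_of:
  "alternating_count \<kappa> s p b (frag_of f) = of_bool (alternating_simplex \<kappa> s p b f)"
  by (simp add: alternating_count_def)

lemma alternating_count_diff:
  "alternating_count \<kappa> s p b (c - d) = alternating_count \<kappa> s p b c - alternating_count \<kappa> s p b d"
  by (simp add: alternating_count_def frag_extend_diff lookup_minus)

lemma alternating_count_add: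
  "alternating_count \<kappa> s p b (c + d) = alternating_count \<kappa> s p b c + alternating_count \<kappa> s p b d"
  by (simp add: alternating_count_def frag_extend_add lookup_add)

lemma alternating_count_cmul:
  "alternating_count \<kappa> s p b (frag_cmul r c) = r * alternating_count \<kappa> s p b c"
  by (simp add: alternating_count_def frag_extend_cmul)

lemma alternating_count_sum:
  "finite I \<Longrightarrow> alternating_count \<kappa> s p b (sum g I) = (\<Sum>i\<in>I. alternating_count \<kappa> s p b (g i))"
  by (induction I rule: finite_induct) (auto simp: alternating_count_0 alternating_count_add)

text \<open>Omitting an index commutes with stable sorting. \<open>L\<close> holds indices rather
  than points because \<open>even_alternates_remove\<close> asks for distinct entries.\<close>

lemma alternating_simplex_face:
  fixes \<kappa> s p and f :: "(nat \<Rightarrow> real) \<Rightarrow> 'a"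
  defines "L \<equiv> sort_key (\<lambda>i. \<kappa> (f (vertex i))) [0..<Suc (Suc p)]"
  assumes "k \<le> Suc p"
  shows "alternating_simplex \<kappa> s p b (singular_face (Suc p) k f)
    \<longleftrightarrow> alternates b (map (\<lambda>i. s (f (vertex i))) (filter (\<lambda>i. i \<noteq> k) L))"
proof -
  have "map (\<lambda>i. singular_face (Suc p) k f (vertex i)) [0..<Suc p]
      = map (\<lambda>i. f (vertex i)) (map (\<lambda>i. if i < k then i else Suc i) [0..<Suc p])"
    by (auto simp: singular_face_vertex simp del: upt_Suc)
  also have "\<dots> = map (\<lambda>i. f (vertex i)) (filter (\<lambda>i. i \<noteq> k) [0..<Suc (Suc p)])"
    using map_skip_upt[OF assms(2)] by simp
  finally have "sort_key \<kappa> (map (\<lambda>i. singular_face (Suc p) k f (vertex i)) [0..<Suc p])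
      = map (\<lambda>i. f (vertex i)) (filter (\<lambda>i. i \<noteq> k) L)"
    unfolding L_def by (simp only: map_sort_key[symmetric] filter_sort)
  then show ?thesis
    unfolding alternating_simplex_def by (simp add: comp_def del: upt_Suc)
qed

text \<open>By linearity one simplex suffices; modulo 2 the boundary signs disappear, and
  \<open>even_alternates_remove\<close> applies to its sorted vertices.\<close>

lemma alternating_count_boundary:
  "even (alternating_count \<kappa> s p b (chain_boundary (Suc p) c)
    + alternating_count \<kappa> s (Suc p) b c + alternating_count \<kappa> s (Suc p) (\<not> b) c)"
proof -
  have "Poly_Mapping.keys c \<subseteq> UNIV" by simp
  then show ?thesis
  proof (induction c rule: frag_induction)
    case (one f)
    define L where "L = sort_key (\<lambda>i. \<kappa> (f (vertex i))) [0..<Suc (Suc p)]"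
    define a :: "nat \<Rightarrow> int"
      where "a k = of_bool (alternating_simplex \<kappa> s p b (singular_face (Suc p) k f))" for k
    have simplex: "alternating_simplex \<kappa> s (Suc p) b' f
        \<longleftrightarrow> alternates b' (map (\<lambda>i. s (f (vertex i))) L)" for b'
      unfolding alternating_simplex_def L_def map_sort_key[symmetric] by (simp add: comp_def del: upt_Suc)
    have "(\<Sum>k\<le>Suc p. a k) = (\<Sum>k\<in>set L. of_bool (alternates b (map (\<lambda>i. s (f (vertex i))) (filter (\<lambda>i. i \<noteq> k) L))))"
      unfolding a_def L_def
      by (intro sum.cong) (auto simp: alternating_simplex_face atLeast0LessThan lessThan_Suc_atMost simp del: upt_Suc)
    moreover have "distinct L" unfolding L_def by (simp del: upt_Suc)
    ultimately have "even ((\<Sum>k\<le>Suc p. a k) + of_bool (alternating_simplex \<kappa> s (Suc p) b f)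
        + of_bool (alternating_simplex \<kappa> s (Suc p) (\<not> b) f))"
      using even_alternates_remove[of L b "\<lambda>i. s (f (vertex i))"] by (simp add: simplex)
    moreover have "even ((\<Sum>k\<le>Suc p. (-1) ^ k * a k) - (\<Sum>k\<le>Suc p. a k))"
      unfolding sum_subtractf[symmetric] by (intro dvd_sum) simp
    moreover have "alternating_count \<kappa> s p b (chain_boundary (Suc p) (frag_of f)) = (\<Sum>k\<le>Suc p. (-1) ^ k * a k)"
      by (simp add: chain_boundary_of alternating_count_sum alternating_count_cmul alternating_count_add
          alternating_count_of a_def del: sum.atMost_Suc)
    ultimately show ?case by (simp add: alternating_count_of)
  next
    case (diff c d)
    then show ?case by (auto simp: chain_boundary_diff alternating_count_diff)
  qed (simp add: alternating_count_0)
qed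

text \<open>The antipode preserves the keys, hence the sorted order, and flips every sign.\<close>

lemma alternating_count_antipode:
  fixes c :: "'a::real_normed_vector chain"
  assumes c: "singular_chain p (top_of_set S) c"
    and \<kappa>: "\<And>x. x \<in> S \<Longrightarrow> \<kappa> (- x) = \<kappa> x" and s: "\<And>x. x \<in> S \<Longrightarrow> s (- x) \<longleftrightarrow> \<not> s x"
  shows "alternating_count \<kappa> s p b (chain_map p uminus c) = alternating_count \<kappa> s p (\<not> b) c"
  using c unfolding singular_chain_def
proof (induction c rule: frag_induction)
  case (one f)
  then have f: "f (vertex i) \<in> S" if "i \<le> p" for i
    using that vertex_in_standard_simplex[of i p]
    by (force simp: singular_simplex_def continuous_map_def)
  let ?I = "[0..<Suc p]"
  have I: "set ?I \<subseteq> {..p}" by auto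
  have "map (\<lambda>i. simplex_map p uminus f (vertex i)) ?I = map uminus (map (\<lambda>i. f (vertex i)) ?I)"
    by (auto simp: simplex_map_def)
  moreover have "sort_key \<kappa> (map uminus xs) = map uminus (sort_key \<kappa> xs)" if "set xs \<subseteq> S" for xs
  proof -
    have "map uminus (insort_key \<kappa> a ys) = insort_key \<kappa> (- a) (map uminus ys)"
      if "set (a # ys) \<subseteq> S" for a ys
      using that by (induction ys) (auto simp: \<kappa>)
    then show ?thesis using that by (induction xs) auto
  qed
  moreover have "set (map (\<lambda>i. f (vertex i)) ?I) \<subseteq> S" using f I by auto
  moreover have "map s (map uminus xs) = map (\<lambda>x. \<not> s x) xs" if "set xs \<subseteq> S" for xs
    using that s by auto
  ultimately have "alternating_simplex \<kappa> s p b (simplex_map p uminus f) \<longleftrightarrow> alternating_simplex \<kappa> s p (\<not> b) f"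
    unfolding alternating_simplex_def by (metis alternates_map_Not set_sort)
  then show ?case by (simp add: alternating_count_of)
qed (auto simp: alternating_count_0 alternating_count_diff chain_map_diff)

section \<open>The Borsuk-Ulam theorem\<close>

text \<open>The model of \<open>c\<close> is a closed half of the \<open>p\<close>-sphere. The sign
  makes \<open>c\<close> combined with its antipode a cycle, the algebraic counterpart of the whole
  \<open>p\<close>-sphere, and \<open>d\<close> fills it.\<close>

inductive hemisphere_chain :: "'a::real_normed_vector set \<Rightarrow> nat \<Rightarrow> 'a chain \<Rightarrow> bool" for S where
  point: "singular_simplex 0 (top_of_set S) f \<Longrightarrow> hemisphere_chain S 0 (frag_of f)"
| step: "\<lbrakk>hemisphere_chain S p c; singular_chain (Suc p) (top_of_set S) d;
    chain_boundary (Suc p) d = c + frag_cmul ((-1) ^ Suc p) (chain_map p uminus c)\<rbrakk>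
    \<Longrightarrow> hemisphere_chain S (Suc p) d"

lemma hemisphere_chain_imp_singular_chain:
  "hemisphere_chain S p c \<Longrightarrow> singular_chain p (top_of_set S) c"
  by (induction rule: hemisphere_chain.induct) (auto simp: singular_chain_of)

section \<open>Subdivision and parity of hemisphere chains\<close>

lemma singular_subdivision_cmul:
  "singular_subdivision p (frag_cmul r c) = frag_cmul r (singular_subdivision p c)"
  by (simp add: singular_subdivision_def frag_extend_cmul)

text \<open>Subdivision fixes points and commutes with boundary and antipode, so all chains of the
  sequence can be subdivided together.\<close>

lemma hemisphere_chain_subdivision:
  "hemisphere_chain S p c \<Longrightarrow> hemisphere_chain S p (singular_subdivision p c)"
proof (induction rule: hemisphere_chain.induct)
  case (point f)
  then show ?case
    by (simp add: singular_subdivision_zero singular_chain_of hemisphere_chain.point)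
next
  case (step p c d)
  have "chain_boundary (Suc p) (singular_subdivision (Suc p) d)
      = singular_subdivision p (c + frag_cmul ((-1) ^ Suc p) (chain_map p uminus c))"
    using chain_boundary_singular_subdivision[OF step.hyps(2)] step.hyps(3) by simp
  also have "\<dots> = singular_subdivision p c
      + frag_cmul ((-1) ^ Suc p) (chain_map p uminus (singular_subdivision p c))"
    using naturality_singular_subdivision[OF hemisphere_chain_imp_singular_chain[OF step.hyps(1)], of uminus]
    by (simp only: singular_subdivision_add singular_subdivision_cmul)
  finally show ?case
    using step by (intro hemisphere_chain.step) (auto intro: singular_chain_singular_subdivision)
qed

lemma hemisphere_chain_iterated_subdivision:
  "hemisphere_chain S p c \<Longrightarrow> hemisphere_chain S p ((singular_subdivision p ^^ n) c)"
  by (induction n) (auto intro: hemisphere_chain_subdivision)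

text \<open>A single point alternates with exactly one sign. Modulo 2, the count of \<open>d\<close>
  over both signs is the count of its boundary for \<open>True\<close>, which comes from
  \<open>c\<close> and its antipode; the antipode exchanges the two signs.\<close>

lemma odd_alternating_count_hemisphere:
  assumes "hemisphere_chain S p c"
    and \<kappa>: "\<And>x. x \<in> S \<Longrightarrow> \<kappa> (- x) = \<kappa> x" and s: "\<And>x. x \<in> S \<Longrightarrow> s (- x) \<longleftrightarrow> \<not> s x"
  shows "odd (alternating_count \<kappa> s p True c + alternating_count \<kappa> s p False c)"
  using assms(1)
proof (induction rule: hemisphere_chain.induct)
  case (point f)
  then show ?case by (simp add: alternating_count_of alternating_simplex_def)
next
  case (step p c d)
  have "alternating_count \<kappa> s p True (chain_boundary (Suc p) d)
      = alternating_count \<kappa> s p True c + (-1) ^ Suc p * alternating_count \<kappa> s p False c"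
    using alternating_count_antipode[OF hemisphere_chain_imp_singular_chain[OF step.hyps(1)], of \<kappa> s True] \<kappa> s
    by (simp add: step.hyps(3) alternating_count_add alternating_count_cmul del: power_Suc)
  moreover have "even ((-1) ^ Suc p * x) \<longleftrightarrow> even x" for x :: int by simp
  ultimately show ?case
    using step.IH alternating_count_boundary[of \<kappa> s p True d]
    by (simp only: even_add not_True_eq_False) blast
qed

section \<open>Filling cycles in the sphere\<close>

lemma trivial_homology_group_imp_boundary:
  assumes "trivial_group (homology_group (int p) X)" "singular_relcycle p X {} c"
  shows "singular_relboundary p X {} c"
proof -
  have "homologous_rel_set p X {} c \<in> carrier (homology_group (int p) X)"
    using assms(2) by (simp add: carrier_relative_homology_group)
  then have "homologous_rel_set p X {} c = singular_relboundary_set p X {}"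
    using assms(1) by (simp add: trivial_group_def)
  then show ?thesis by (simp add: homologous_rel_set_eq_relboundary)
qed

lemma trivial_homology_group_sphere:
  assumes "0 < p" "Suc p < DIM('a::euclidean_space)"
  shows "trivial_group (homology_group (int p) (top_of_set (sphere 0 1 :: 'a set)))"
proof -
  obtain f :: "(nat \<Rightarrow> real) \<Rightarrow> 'a" and g
    where "homeomorphic_maps (nsphere (DIM('a) - 1)) (top_of_set (sphere 0 1 \<inter> span Basis)) f g"
    using homeomorphic_maps_nsphere_euclidean_sphere[OF independent_Basis orthogonal_Basis refl, where ?'n = 'a]
    by auto
  then have "nsphere (DIM('a) - 1) homeomorphic_space top_of_set (sphere 0 1 :: 'a set)"
    unfolding homeomorphic_space_def by auto
  then have "homology_group (int p) (nsphere (DIM('a) - 1)) \<cong> homology_group (int p) (top_of_set (sphere 0 1 :: 'a set))"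
    by (rule homeomorphic_space_imp_isomorphic_homology_groups)
  moreover have "trivial_group (homology_group (int p) (nsphere (DIM('a) - 1)))"
    using reduced_homology_group_nsphere(2)[of "int p" "DIM('a) - 1"] assms
      un_reduced_homology_group[of "int p" "nsphere (DIM('a) - 1)"] by simp
  ultimately show ?thesis
    using isomorphic_group_triviality[OF _ group_relative_homology_group group_relative_homology_group] by blast
qed

text \<open>The next chain exists once the previous one combined with its antipode bounds. In degree
  0 this is a difference of two points in a path-connected sphere; otherwise it is a cycle of
  positive degree below the dimension of the sphere.\<close>

lemma hemisphere_chain_exists:
  assumes "p < DIM('a::euclidean_space)"
  shows "\<exists>c. hemisphere_chain (sphere 0 1 :: 'a set) p c"
  using assms
proof (induction p)
  case 0
  obtain b :: 'a where "b \<in> Basis" using nonempty_Basis by blast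
  then have "singular_simplex 0 (top_of_set (sphere 0 1)) (restrict (\<lambda>_. b) (standard_simplex 0))"
    by (auto simp: singular_simplex_def)
  then show ?case by (blast intro: hemisphere_chain.point)
next
  case (Suc p)
  let ?S = "sphere 0 1 :: 'a set"
  let ?X = "top_of_set ?S"
  obtain c where c: "hemisphere_chain ?S p c" using Suc by auto
  have sc: "singular_chain p ?X c" by (rule hemisphere_chain_imp_singular_chain[OF c])
  have cont: "continuous_map ?X ?X uminus" by (auto intro: continuous_intros)
  define e where "e = c + frag_cmul ((-1) ^ Suc p) (chain_map p uminus c)"
  have "singular_relboundary p ?X {} e"
    using c
  proof cases
    case (point f)
    have "path_connected ?S" using Suc.prems point by (intro path_connected_sphere) auto
    then have "path_connected_space ?X" 
      using path_connectedin_def by fastforce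
    moreover have "singular_simplex 0 ?X (simplex_map 0 uminus f)"
      using point cont by (auto intro: singular_simplex_simplex_map)
    ultimately have "homologous_rel 0 ?X {} (frag_of f) (frag_of (simplex_map 0 uminus f))"
      using point by (intro iso_integer_zeroth_homology_group_aux) auto
    then show ?thesis using point by (simp add: e_def homologous_rel_def)
  next
    case (step q c')
    have sc': "singular_chain q ?X c'" by (rule hemisphere_chain_imp_singular_chain) fact
    \<comment> \<open>The boundary of \<open>e\<close> involves the antipode applied twice, which is
      the identity; by the choice of signs all terms then cancel.\<close>
    have "chain_map q (uminus \<circ> uminus) c' = c'"
      by (rule chain_map_id_gen[OF sc']) simp
    then have "chain_map q uminus (chain_map q uminus c') = c'"
      by (simp only: chain_map_compose comp_apply)
    then have "chain_boundary p e = 0"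
      using chain_boundary_chain_map[OF sc, of uminus] step(1,4)
      by (simp add: e_def chain_boundary_add chain_boundary_cmul chain_map_add frag_cmul_distrib2
          flip: frag_cmul_distrib)
    moreover have "singular_chain p ?X e"
      unfolding e_def using sc cont by (intro singular_chain_add singular_chain_cmul singular_chain_chain_map)
    ultimately show ?thesis
      using step(1) Suc.prems by (intro trivial_homology_group_imp_boundary trivial_homology_group_sphere)
        (auto simp: singular_cycle)
  qed
  then obtain d where "singular_chain (Suc p) ?X d" "chain_boundary (Suc p) d = e"
    by (auto simp: singular_boundary)
  then show ?case using c hemisphere_chain.step unfolding e_def by blast
qed

theorem borsuk_ulam:
  fixes f :: "nat \<Rightarrow> 'a::euclidean_space \<Rightarrow> real"
  assumes cont: "\<And>i. i < d \<Longrightarrow> continuous_on (sphere 0 1) (f i)"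
    and odd: "\<And>i x. i < d \<Longrightarrow> x \<in> sphere 0 1 \<Longrightarrow> f i (- x) = - f i x"
    and d: "d < DIM('a)"
  shows "\<exists>x\<in>sphere 0 1. \<forall>i<d. f i x = 0"
proof (rule ccontr)
  let ?S = "sphere 0 1 :: 'a set"
  assume "\<not> ?thesis"
  then have nz: "\<exists>i<d. f i x \<noteq> 0" if "x \<in> ?S" for x using that by blast
  \<comment> \<open>By compactness the sum of the absolute values has a positive minimum
    \<open>?m\<close>, and some summand is at least the average \<open>?m / d\<close>.\<close>
  obtain \<epsilon> where \<epsilon>: "\<epsilon> > 0" "\<And>x. x \<in> ?S \<Longrightarrow> \<exists>i<d. \<bar>f i x\<bar> \<ge> \<epsilon>"
  proof -
    have "continuous_on ?S (\<lambda>x. \<Sum>i<d. \<bar>f i x\<bar>)"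
      using cont by (intro continuous_on_sum continuous_on_rabs) auto
    moreover have "?S \<noteq> {}" by simp
    ultimately obtain x0 where x0: "x0 \<in> ?S"
      and min: "\<And>x. x \<in> ?S \<Longrightarrow> (\<Sum>i<d. \<bar>f i x0\<bar>) \<le> (\<Sum>i<d. \<bar>f i x\<bar>)"
      using continuous_attains_inf[of ?S "\<lambda>x. \<Sum>i<d. \<bar>f i x\<bar>"] compact_sphere by blast
    let ?m = "\<Sum>i<d. \<bar>f i x0\<bar>"
    have "?m > 0" using nz[OF x0] by (auto intro!: sum_pos2)
    moreover from this have d0: "d > 0" by (cases d) auto
    moreover have "\<exists>i<d. \<bar>f i x\<bar> \<ge> ?m / d" if x: "x \<in> ?S" for x
    proof (rule ccontr)
      assume "\<not> ?thesis"
      then have "(\<Sum>i<d. \<bar>f i x\<bar>) < of_nat (card {..<d}) * (?m / d)"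
        using d0 by (intro sum_bounded_above_strict) (auto simp: not_le)
      then show False using min[OF x] d0 by simp
    qed
    ultimately show ?thesis using that[of "?m / d"] by simp
  qed
  define \<kappa> where "\<kappa> x = (LEAST i. i < d \<and> \<bar>f i x\<bar> \<ge> \<epsilon>)" for x
  define s where "s x \<longleftrightarrow> f (\<kappa> x) x > 0" for x
  have \<kappa>: "\<kappa> x < d" "\<bar>f (\<kappa> x) x\<bar> \<ge> \<epsilon>" if "x \<in> ?S" for x
    using LeastI_ex[of "\<lambda>i. i < d \<and> \<bar>f i x\<bar> \<ge> \<epsilon>"] \<epsilon>(2)[OF that] unfolding \<kappa>_def by auto
  have \<kappa>_neg: "\<kappa> (- x) = \<kappa> x" if "x \<in> ?S" for x
    unfolding \<kappa>_def using odd[OF _ that] by (intro arg_cong[of _ _ Least]) (auto simp: fun_eq_iff)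
  have s_neg: "s (- x) \<longleftrightarrow> \<not> s x" if "x \<in> ?S" for x
    using \<kappa>[OF that] \<kappa>_neg[OF that] odd[OF _ that] \<epsilon>(1) unfolding s_def by force
  \<comment> \<open>Two values of \<open>f i\<close> on \<open>U y\<close> differ by less than
    \<open>2 * \<epsilon>\<close>, so they cannot have opposite signs and both be at least
    \<open>\<epsilon>\<close> in absolute value.\<close>
  define U where "U y = {x \<in> ?S. \<forall>i<d. \<bar>f i x - f i y\<bar> < \<epsilon>}" for y
  have U_open: "openin (top_of_set ?S) (U y)" for y
  proof -
    have "openin (top_of_set ?S) {x \<in> ?S. \<bar>f i x - f i y\<bar> < \<epsilon>}" if "i < d" for i
    proof -
      have "continuous_on ?S (\<lambda>x. \<bar>f i x - f i y\<bar>)"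
        by (intro continuous_on_rabs continuous_on_diff cont[OF that] continuous_on_const)
      from continuous_openin_preimage_gen[OF this open_lessThan[of \<epsilon>]] show ?thesis
        by (simp add: vimage_def Int_def)
    qed
    then have "openin (top_of_set ?S) (\<Inter>i\<in>{..<d}. {x \<in> ?S. \<bar>f i x - f i y\<bar> < \<epsilon>} )" if "d \<noteq> 0"
      using that by (intro openin_INT2) auto
    \<comment> \<open>A basis vector lies on the sphere, so some \<open>f i\<close> is nonzero
      there. An intersection over no index would be the whole space instead of
      \<open>U y\<close>.\<close>
    moreover have "d \<noteq> 0" using nz[of "SOME i. i \<in> Basis"] by (auto simp: SOME_Basis)
    moreover from this have "U y = (\<Inter>i\<in>{..<d}. {x \<in> ?S. \<bar>f i x - f i y\<bar> < \<epsilon>})"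
      unfolding U_def by auto
    ultimately show ?thesis by simp
  qed
  have U_cover: "topspace (top_of_set ?S) \<subseteq> \<Union>(U ` ?S)"
    using \<epsilon>(1) by (auto simp: U_def)
  obtain c where c: "hemisphere_chain ?S d c" using hemisphere_chain_exists[OF d] by blast
  have "\<exists>n. \<forall>g\<in>Poly_Mapping.keys ((singular_subdivision d ^^ n) c).
      \<exists>V \<in> U ` ?S. g \<in> standard_simplex d \<rightarrow> V"
  proof (rule sufficient_iterated_singular_subdivision_exists
      [OF _ U_cover hemisphere_chain_imp_singular_chain[OF c]])
    show "openin (top_of_set ?S) V" if "V \<in> U ` ?S" for V using that U_open by blast
  qed blast
  then obtain n where n: "\<And>g. g \<in> Poly_Mapping.keys ((singular_subdivision d ^^ n) c)
      \<Longrightarrow> \<exists>V \<in> U ` ?S. g \<in> standard_simplex d \<rightarrow> V"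
    by blast
  have "\<not> alternating_simplex \<kappa> s d b g" if g: "g \<in> Poly_Mapping.keys ((singular_subdivision d ^^ n) c)" for b g
  proof
    assume alt: "alternating_simplex \<kappa> s d b g"
    obtain y where y: "y \<in> ?S" "g \<in> standard_simplex d \<rightarrow> U y" using n[OF g] by blast
    define L where "L = sort_key \<kappa> (map (\<lambda>i. g (vertex i)) [0..<Suc d])"
    have len: "length L = Suc d" unfolding L_def by simp
    have mem: "L ! j \<in> U y" if "j \<le> d" for j
    proof -
      have "set L \<subseteq> U y" using y(2) by (auto simp: L_def Pi_iff simp del: upt_Suc)
      then show ?thesis using that len by (auto simp: subset_iff)
    qed
    then have S: "L ! j \<in> ?S" if "j \<le> d" for j using that unfolding U_def by blast
    have "sorted (map \<kappa> L)" unfolding L_def by (rule sorted_sort_key)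
    then have le: "\<kappa> (L ! j) \<le> \<kappa> (L ! Suc j)" if "j < d" for j
      using that len sorted_nth_mono[of "map \<kappa> L" j "Suc j"] by auto
    \<comment> \<open>Otherwise the sorted labels of the \<open>d + 1\<close> vertices increase
      strictly, and the last one is at least \<open>d\<close>.\<close>
    have "\<exists>j<d. \<kappa> (L ! Suc j) = \<kappa> (L ! j)"
    proof (rule ccontr)
      assume "\<not> ?thesis"
      then have less: "\<kappa> (L ! j) < \<kappa> (L ! Suc j)" if "j < d" for j
        using le[OF that] that by force
      have "j \<le> \<kappa> (L ! j)" if "j \<le> d" for j
        using that
      proof (induction j)
        case (Suc j)
        then show ?case using less[of j] by simp
      qed simp
      then show False using \<kappa>(1)[OF S, of d] by fastforce
    qed
    then obtain j where j: "j < d" "\<kappa> (L ! Suc j) = \<kappa> (L ! j)" by blast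
    define i where "i = \<kappa> (L ! j)"
    have "s (L ! Suc j) \<longleftrightarrow> \<not> s (L ! j)"
      using alternates_nth_Suc[of b "map s L" j] alt j(1) len
      unfolding alternating_simplex_def L_def[symmetric] by simp
    moreover have "i < d" "\<bar>f i (L ! j)\<bar> \<ge> \<epsilon>" "\<bar>f i (L ! Suc j)\<bar> \<ge> \<epsilon>"
      using \<kappa>[OF S[of j]] \<kappa>[OF S[of "Suc j"]] j unfolding i_def by auto
    moreover have "\<bar>f i (L ! j) - f i y\<bar> < \<epsilon>" "\<bar>f i (L ! Suc j) - f i y\<bar> < \<epsilon>"
      using mem[of j] mem[of "Suc j"] j(1) \<open>i < d\<close> unfolding U_def by auto
    ultimately show False using j(2) unfolding s_def i_def[symmetric] by (auto simp: abs_if split: if_splits)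
  qed
  then have "alternating_count \<kappa> s d b ((singular_subdivision d ^^ n) c) = 0" for b
    unfolding alternating_count_def by (subst frag_extend_eq_0) auto
  then show False
    using odd_alternating_count_hemisphere[OF hemisphere_chain_iterated_subdivision[OF c, of n], of \<kappa> s]
      \<kappa>_neg s_neg by simp
qed

section \<open>Tilted medians of mass distributions\<close>

definition lower_mass :: "(real ^ 'n) measure \<Rightarrow> real ^ 'n \<Rightarrow> real \<Rightarrow> real" where
  "lower_mass M v t = measure M {x. v \<bullet> x \<le> t}"

lemma mass_distributionD:
  assumes "mass_distribution M"
  shows "finite_measure M" "sets M = sets borel" "space M = UNIV"
    "{x. v \<bullet> x \<le> t} \<in> sets M" "{x. v \<bullet> x \<ge> t} \<in> sets M" "{x. v \<bullet> x = t} \<in> sets M"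
proof -
  show fin: "finite_measure M" and sets: "sets M = sets borel"
    using assms by (auto simp: mass_distribution_def)
  show "space M = UNIV" using sets_eq_imp_space_eq[OF sets] by simp
  show "{x. v \<bullet> x \<le> t} \<in> sets M" "{x. v \<bullet> x \<ge> t} \<in> sets M" "{x. v \<bullet> x = t} \<in> sets M"
    unfolding sets by (auto intro!: borel_closed simp: closed_halfspace_le closed_halfspace_ge closed_hyperplane)
qed

lemma null_sets_hyperplane:
  assumes M: "mass_distribution M" and "v \<noteq> 0"
  shows "{x. v \<bullet> x = t} \<in> null_sets M"
proof -
  have "negligible {x. v \<bullet> x = t}" using assms by (auto intro: negligible_hyperplane)
  then have "{x. v \<bullet> x = t} \<in> null_sets lborel"
    using negligible_iff_null_sets[of "{x. v \<bullet> x = t}"] 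
    by (simp add: null_sets_def closed_hyperplane borel_closed)
  then show ?thesis using M by (auto simp: mass_distribution_def absolutely_continuous_def)
qed

text \<open>The two closed half-spaces overlap only in a hyperplane, which is null by absolute
  continuity.\<close>

lemma upper_mass_eq:
  assumes M: "mass_distribution M" and v: "v \<noteq> 0"
  shows "measure M {x. v \<bullet> x \<ge> t} = measure M UNIV - lower_mass M v t"
proof -
  interpret finite_measure M using mass_distributionD[OF M] by simp
  note sets = mass_distributionD(3-)[OF M]
  have "measure M UNIV = measure M ({x. v \<bullet> x \<ge> t} \<union> ({x. v \<bullet> x \<le> t} - {x. v \<bullet> x = t}))"
    by (rule arg_cong[of _ _ "measure M"]) auto
  also have "\<dots> = measure M {x. v \<bullet> x \<ge> t} + measure M ({x. v \<bullet> x \<le> t} - {x. v \<bullet> x = t})"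
    using sets by (intro finite_measure_Union) auto
  also have "measure M ({x. v \<bullet> x \<le> t} - {x. v \<bullet> x = t}) = lower_mass M v t"
    unfolding lower_mass_def using null_sets_hyperplane[OF M v] sets by (intro measure_Diff_null_set) auto
  finally show ?thesis by simp
qed

text \<open>Negating direction and offset keeps the hyperplane and exchanges its sides; this is the
  source of oddness for the Borsuk-Ulam theorem.\<close>

lemma lower_mass_minus:
  assumes M: "mass_distribution M" and v: "v \<noteq> 0"
  shows "lower_mass M (- v) (- t) = measure M UNIV - lower_mass M v t"
  using upper_mass_eq[OF assms] unfolding lower_mass_def by simp

lemma lower_mass_mono:
  assumes M: "mass_distribution M" and "t \<le> t'"
  shows "lower_mass M v t \<le> lower_mass M v t'"
proof -
  interpret finite_measure M using mass_distributionD[OF M] by simp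
  show ?thesis
    unfolding lower_mass_def using assms mass_distributionD(4)[OF M] by (intro finite_measure_mono) auto
qed

lemma lower_mass_bounds:
  assumes M: "mass_distribution M"
  shows "0 \<le> lower_mass M v t" "lower_mass M v t \<le> measure M UNIV"
proof -
  interpret finite_measure M using mass_distributionD[OF M] by simp
  show "0 \<le> lower_mass M v t" "lower_mass M v t \<le> measure M UNIV"
    unfolding lower_mass_def using bounded_measure[of "{x. v \<bullet> x \<le> t}"] mass_distributionD(3)[OF M] by auto
qed

text \<open>Off the limiting hyperplane, a null set, membership in the half-spaces is eventually
  constant. The constant 1 dominates the indicators and is integrable.\<close>

lemma tendsto_lower_mass:
  assumes M: "mass_distribution M" and v0: "v0 \<noteq> 0"
    and v: "v \<longlonglongrightarrow> v0" and t: "t \<longlonglongrightarrow> t0"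
  shows "(\<lambda>n. lower_mass M (v n) (t n)) \<longlonglongrightarrow> lower_mass M v0 t0"
proof -
  interpret finite_measure M using mass_distributionD[OF M] by simp
  note sets = mass_distributionD(4)[OF M] mass_distributionD(3)[OF M]
  have "(\<lambda>n. \<integral>x. indicator {x. v n \<bullet> x \<le> t n} x \<partial>M) \<longlonglongrightarrow> (\<integral>x. indicator {x. v0 \<bullet> x \<le> t0} x \<partial>M :: real)"
  proof (rule integral_dominated_convergence[where w = "\<lambda>_. 1"])
    have "(\<lambda>n. indicator {x. v n \<bullet> x \<le> t n} x :: real) \<longlonglongrightarrow> indicator {x. v0 \<bullet> x \<le> t0} x"
      if "v0 \<bullet> x \<noteq> t0" for x
    proof -
      have lim: "(\<lambda>n. t n - v n \<bullet> x) \<longlonglongrightarrow> t0 - v0 \<bullet> x"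
        using v t by (intro tendsto_intros)
      have "\<forall>\<^sub>F n in sequentially. (v n \<bullet> x \<le> t n) = (v0 \<bullet> x \<le> t0)"
      proof (cases "v0 \<bullet> x < t0")
        case True
        then have "\<forall>\<^sub>F n in sequentially. 0 < t n - v n \<bullet> x"
          using order_tendstoD(1)[OF lim, of 0] by simp
        then show ?thesis by eventually_elim (use True in simp)
      next
        case False
        then have "\<forall>\<^sub>F n in sequentially. t n - v n \<bullet> x < 0"
          using order_tendstoD(2)[OF lim, of 0] that by simp
        then show ?thesis by eventually_elim (use False that in simp)
      qed
      then have "\<forall>\<^sub>F n in sequentially.
          (indicator {x. v n \<bullet> x \<le> t n} x :: real) = indicator {x. v0 \<bullet> x \<le> t0} x"
        by eventually_elim (simp add: indicator_def)
      then show ?thesis by (rule tendsto_eventually)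
    qed
    then show "AE x in M. (\<lambda>n. indicator {x. v n \<bullet> x \<le> t n} x :: real) \<longlonglongrightarrow> indicator {x. v0 \<bullet> x \<le> t0} x"
      by (intro AE_I'[OF null_sets_hyperplane[OF M v0, of t0]]) auto
  qed (use sets in auto)
  then show ?thesis using sets by (simp add: lower_mass_def)
qed

text \<open>For \<open>\<epsilon> > 0\<close> the tilt \<open>\<epsilon> * t\<close> increases
  strictly in \<open>t\<close>, which makes zeros unique, and it is odd in \<open>t\<close>, which
  preserves the antisymmetry.\<close>

definition tilted_mass :: "(real ^ 'n) measure \<Rightarrow> real \<Rightarrow> real ^ 'n \<Rightarrow> real \<Rightarrow> real" where
  "tilted_mass M \<epsilon> v t = lower_mass M v t - measure M UNIV / 2 + \<epsilon> * t"

lemma tendsto_tilted_mass: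
  assumes "mass_distribution M" "v0 \<noteq> 0" "v \<longlonglongrightarrow> v0" "t \<longlonglongrightarrow> t0"
  shows "(\<lambda>n. tilted_mass M \<epsilon> (v n) (t n)) \<longlonglongrightarrow> tilted_mass M \<epsilon> v0 t0"
  unfolding tilted_mass_def
  by (intro tendsto_add tendsto_diff tendsto_mult tendsto_const assms tendsto_lower_mass[OF assms])

lemma tilted_mass_strict_mono:
  assumes "mass_distribution M" "\<epsilon> > 0" "t < t'"
  shows "tilted_mass M \<epsilon> v t < tilted_mass M \<epsilon> v t'"
proof -
  have "\<epsilon> * t < \<epsilon> * t'" using assms by simp
  then show ?thesis
    using lower_mass_mono[OF assms(1), of t t' v] assms(3) unfolding tilted_mass_def by linarith
qed

lemma tilted_mass_less_iff:
  assumes "mass_distribution M" "\<epsilon> > 0"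
  shows "tilted_mass M \<epsilon> v t < tilted_mass M \<epsilon> v t' \<longleftrightarrow> t < t'"
  using tilted_mass_strict_mono[OF assms, of t t' v] tilted_mass_strict_mono[OF assms, of t' t v]
  by (cases t t' rule: linorder_cases) auto

lemma tilted_mass_zero_exists:
  assumes M: "mass_distribution M" and \<epsilon>: "\<epsilon> > 0" and v: "v \<noteq> 0"
  shows "\<exists>t. tilted_mass M \<epsilon> v t = 0"
proof -
  \<comment> \<open>At \<open>T\<close> and \<open>- T\<close> the tilt is half the total mass with
    either sign, which fixes the sign of the tilted mass there.\<close>
  define T where "T = measure M UNIV / 2 / \<epsilon>"
  have T: "\<epsilon> * T = measure M UNIV / 2" "T \<ge> 0" using \<epsilon> by (auto simp: T_def)
  have "continuous_on UNIV (tilted_mass M \<epsilon> v)"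
    unfolding continuous_on_sequentially comp_def using tendsto_tilted_mass[OF M v tendsto_const] by blast
  then have "continuous_on {-T..T} (tilted_mass M \<epsilon> v)" by (rule continuous_on_subset) simp
  moreover have "tilted_mass M \<epsilon> v (-T) \<le> 0" "0 \<le> tilted_mass M \<epsilon> v T"
    using lower_mass_bounds[OF M, of v T] lower_mass_bounds[OF M, of v "-T"] T(1)
    by (simp_all add: tilted_mass_def)
  ultimately show ?thesis
    using IVT'[of "tilted_mass M \<epsilon> v" "-T" 0 T] T(2) by auto
qed

definition tilted_median :: "(real ^ 'n) measure \<Rightarrow> real \<Rightarrow> real ^ 'n \<Rightarrow> real" where
  "tilted_median M \<epsilon> v = (THE t. tilted_mass M \<epsilon> v t = 0)"

lemma tilted_median_iff:
  assumes M: "mass_distribution M" and \<epsilon>: "\<epsilon> > 0" and v: "v \<noteq> 0"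
  shows "tilted_median M \<epsilon> v = t \<longleftrightarrow> tilted_mass M \<epsilon> v t = 0"
proof -
  have "\<exists>!t. tilted_mass M \<epsilon> v t = 0"
    using tilted_mass_zero_exists[OF assms] tilted_mass_less_iff[OF M \<epsilon>, of v]
    by (metis linorder_neq_iff)
  then show ?thesis
    unfolding tilted_median_def using theI'[of "\<lambda>t. tilted_mass M \<epsilon> v t = 0"] the1_equality by blast
qed

lemma tilted_median_minus:
  assumes M: "mass_distribution M" and \<epsilon>: "\<epsilon> > 0" and v: "v \<noteq> 0"
  shows "tilted_median M \<epsilon> (- v) = - tilted_median M \<epsilon> v"
proof -
  have "tilted_mass M \<epsilon> v (tilted_median M \<epsilon> v) = 0" using tilted_median_iff[OF assms] by blast
  then have "tilted_mass M \<epsilon> (- v) (- tilted_median M \<epsilon> v) = 0"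
    unfolding tilted_mass_def lower_mass_minus[OF M v] by (simp add: field_simps)
  then show ?thesis using tilted_median_iff[OF M \<epsilon>, of "- v"] v by simp
qed

text \<open>An offset \<open>a\<close> lies below or above the median according to the sign of the
  tilted mass at \<open>a\<close>, and at fixed \<open>a\<close> a strict sign is an open condition
  on \<open>v\<close>.\<close>

lemma continuous_on_tilted_median:
  assumes M: "mass_distribution M" and \<epsilon>: "\<epsilon> > 0"
  shows "continuous_on (- {0}) (tilted_median M \<epsilon>)"
  unfolding continuous_on_def
proof
  fix v0 :: "real ^ 'a" assume v0: "v0 \<in> - {0}"
  have zero: "tilted_mass M \<epsilon> v (tilted_median M \<epsilon> v) = 0" if "v \<noteq> 0" for v
    using tilted_median_iff[OF M \<epsilon> that] by blast
  have "continuous_on (- {0}) (\<lambda>v. tilted_mass M \<epsilon> v t)" for t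
    unfolding continuous_on_sequentially comp_def
    using tendsto_tilted_mass[OF M _ _ tendsto_const] by blast
  then have lim: "((\<lambda>v. tilted_mass M \<epsilon> v t) \<longlongrightarrow> tilted_mass M \<epsilon> v0 t) (at v0 within - {0})" for t
    using v0 unfolding continuous_on_def by blast
  have nz: "\<forall>\<^sub>F v in at v0 within - {0}. v \<noteq> 0"
    by (auto simp: eventually_at_filter)
  show "(tilted_median M \<epsilon> \<longlongrightarrow> tilted_median M \<epsilon> v0) (at v0 within - {0})"
  proof (rule order_tendstoI)
    fix a assume "a < tilted_median M \<epsilon> v0"
    then have "tilted_mass M \<epsilon> v0 a < 0"
      using tilted_mass_less_iff[OF M \<epsilon>, of v0 a] zero[of v0] v0 by (metis ComplD singletonI)
    from order_tendstoD(2)[OF lim this] nz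
    show "\<forall>\<^sub>F v in at v0 within - {0}. a < tilted_median M \<epsilon> v"
      by eventually_elim (metis zero tilted_mass_less_iff[OF M \<epsilon>])
  next
    fix a assume "tilted_median M \<epsilon> v0 < a"
    then have "tilted_mass M \<epsilon> v0 a > 0"
      using tilted_mass_less_iff[OF M \<epsilon>, of v0 _ a] zero[of v0] v0 by (metis ComplD singletonI)
    from order_tendstoD(1)[OF lim this] nz
    show "\<forall>\<^sub>F v in at v0 within - {0}. tilted_median M \<epsilon> v < a"
      by eventually_elim (metis zero tilted_mass_less_iff[OF M \<epsilon>])
  qed
qed

text \<open>A ball with more than half the mass confines the medians: for a hyperplane missing it,
  defect and tilt would have the same nonzero sign. The bound is uniform in
  \<open>\<epsilon>\<close>, as the limit requires.\<close>

lemma tilted_median_bounded: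
  assumes M: "mass_distribution M"
  obtains R where "\<And>\<epsilon> v. \<epsilon> > 0 \<Longrightarrow> norm v = 1 \<Longrightarrow> \<bar>tilted_median M \<epsilon> v\<bar> \<le> R"
proof -
  interpret finite_measure M using mass_distributionD[OF M] by simp
  note sets = mass_distributionD(2-)[OF M]
  let ?m = "measure M UNIV"
  have zero: "lower_mass M v (tilted_median M \<epsilon> v) - ?m / 2 + \<epsilon> * tilted_median M \<epsilon> v = 0"
    if "\<epsilon> > 0" "norm v = 1" for \<epsilon> v
    using tilted_median_iff[OF M that(1), of v] that(2) unfolding tilted_mass_def by force
  show ?thesis
  proof (cases "?m = 0")
    \<comment> \<open>A zero measure has no such ball, but then the tilt alone must vanish, so the
      median is 0.\<close>
    case True
    then have "lower_mass M v t = 0" for v t using lower_mass_bounds[OF M, of v t] by simp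
    then have "\<bar>tilted_median M \<epsilon> v\<bar> \<le> 0" if "\<epsilon> > 0" "norm v = 1" for \<epsilon> v
      using zero[OF that] True that by simp
    then show ?thesis using that by blast
  next
    case False
    have "(\<lambda>n. measure M (cball 0 (real n))) \<longlonglongrightarrow> measure M (\<Union>n. cball 0 (real n))"
      using sets by (intro finite_Lim_measure_incseq) (auto simp: incseq_def)
    moreover have "(\<Union>n. cball 0 (real n)) = (UNIV :: (real ^ 'a) set)"
      by (auto simp: real_arch_simple)
    ultimately have "(\<lambda>n. measure M (cball 0 (real n))) \<longlonglongrightarrow> ?m" by simp
    moreover have "?m / 2 < ?m" using False zero_less_measure_iff[of M UNIV] by simp
    ultimately have "\<forall>\<^sub>F n in sequentially. ?m / 2 < measure M (cball 0 (real n))"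
      by (rule order_tendstoD(1))
    then obtain n where n: "measure M (cball 0 (real n)) > ?m / 2"
      by (auto simp: eventually_sequentially)
    have "\<bar>tilted_median M \<epsilon> v\<bar> \<le> n" if \<epsilon>: "\<epsilon> > 0" and v: "norm v = 1" for \<epsilon> v
    proof (rule ccontr)
      let ?t = "tilted_median M \<epsilon> v"
      assume "\<not> \<bar>?t\<bar> \<le> n"
      then consider "?t > n" | "?t < - real n" by linarith
      then show False
      proof cases
        case 1
        have "cball 0 (real n) \<subseteq> {x. v \<bullet> x \<le> ?t}"
        proof
          fix x :: "real ^ 'a" assume "x \<in> cball 0 (real n)"
          then show "x \<in> {x. v \<bullet> x \<le> ?t}" using norm_cauchy_schwarz[of v x] v 1 by simp
        qed
        then have "measure M (cball 0 (real n)) \<le> lower_mass M v ?t"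
          unfolding lower_mass_def using sets by (intro finite_measure_mono) auto
        moreover have "\<epsilon> * ?t > 0" using 1 \<epsilon> by simp
        ultimately show False using zero[OF that] n by linarith
      next
        case 2
        have "cball 0 (real n) \<subseteq> {x. v \<bullet> x \<ge> ?t}"
        proof
          fix x :: "real ^ 'a" assume "x \<in> cball 0 (real n)"
          then show "x \<in> {x. v \<bullet> x \<ge> ?t}" using norm_cauchy_schwarz[of "- v" x] v 2 by simp
        qed
        then have "measure M (cball 0 (real n)) \<le> measure M {x. v \<bullet> x \<ge> ?t}"
          using sets by (intro finite_measure_mono) auto
        also have "\<dots> = ?m - lower_mass M v ?t" using upper_mass_eq[OF M, of v ?t] v by force
        finally have "lower_mass M v ?t < ?m / 2" using n by linarith
        moreover have "\<epsilon> * ?t < 0" using 2 \<epsilon> by (simp add: mult_pos_neg)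
        ultimately show False using zero[OF that] by linarith
      qed
    qed
    then show ?thesis using that by blast
  qed
qed

section \<open>Limits of tilted bisectors\<close>

lemma tilted_median_balanced:
  assumes "mass_distribution M" "\<epsilon> > 0" "v \<noteq> 0"
  shows "lower_mass M v (tilted_median M \<epsilon> v) = measure M UNIV / 2 - \<epsilon> * tilted_median M \<epsilon> v"
proof -
  have "tilted_mass M \<epsilon> v (tilted_median M \<epsilon> v) = 0" using tilted_median_iff[OF assms] by blast
  then show ?thesis unfolding tilted_mass_def by linarith
qed

lemma equipartitions_hyperplane:
  assumes M: "mass_distribution M" and v: "v \<noteq> 0" and t: "lower_mass M v t = measure M UNIV / 2"
  shows "equipartitions {x. v \<bullet> x = t} M"
  unfolding equipartitions_def
proof (intro exI conjI)
  show "measure M {x. v \<bullet> x \<le> t} = measure M UNIV / 2"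
    using t by (simp add: lower_mass_def)
  show "measure M {x. v \<bullet> x \<ge> t} = measure M UNIV / 2"
    using upper_mass_eq[OF M v, of t] t by simp
qed (use v in auto)

text \<open>The offsets are bounded, so a subsequence converges, and half-space masses are jointly
  continuous in normal and offset. The tilt tends to 0 along this subsequence.\<close>

lemma limit_of_tilted_bisectors:
  fixes \<mu> :: "nat \<Rightarrow> (real ^ 'n) measure"
  assumes M: "\<And>j. j < m \<Longrightarrow> mass_distribution (\<mu> j)" and m: "m \<ge> 1"
    and \<epsilon>: "\<And>n. \<epsilon> n > 0" "\<epsilon> \<longlonglongrightarrow> 0"
    and v: "\<And>n. norm (v n) = 1" "v \<longlonglongrightarrow> v0"
    and balanced: "\<And>n j. 1 \<le> j \<Longrightarrow> j < m \<Longrightarrow>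
      lower_mass (\<mu> j) (v n) (tilted_median (\<mu> 0) (\<epsilon> n) (v n)) = measure (\<mu> j) UNIV / 2"
  shows "\<exists>t. \<forall>j<m. equipartitions {x. v0 \<bullet> x = t} (\<mu> j)"
proof -
  have M0: "mass_distribution (\<mu> 0)" using M[of 0] m by simp
  define t where "t n = tilted_median (\<mu> 0) (\<epsilon> n) (v n)" for n
  obtain R where R: "\<And>\<epsilon> v. \<epsilon> > 0 \<Longrightarrow> norm v = 1 \<Longrightarrow> \<bar>tilted_median (\<mu> 0) \<epsilon> v\<bar> \<le> R"
    using tilted_median_bounded[OF M0] by blast
  have "bounded (range t)"
    using R[OF \<epsilon>(1) v(1)] by (intro boundedI[of _ R]) (auto simp: t_def)
  then obtain t0 r where r: "strict_mono r" "(t \<circ> r) \<longlonglongrightarrow> t0"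
    using bounded_imp_convergent_subsequence by blast
  have v0: "v0 \<noteq> 0"
    using tendsto_norm[OF v(2)] v(1) by (auto simp: LIMSEQ_const_iff)
  have vr: "(\<lambda>n. v (r n)) \<longlonglongrightarrow> v0" and \<epsilon>r: "(\<lambda>n. \<epsilon> (r n)) \<longlonglongrightarrow> 0"
    using LIMSEQ_subseq_LIMSEQ[OF v(2) r(1)] LIMSEQ_subseq_LIMSEQ[OF \<epsilon>(2) r(1)] by (auto simp: comp_def)
  have tr: "(\<lambda>n. t (r n)) \<longlonglongrightarrow> t0" using r(2) by (simp add: comp_def)
  have "lower_mass (\<mu> j) v0 t0 = measure (\<mu> j) UNIV / 2" if j: "j < m" for j
  proof -
    have lim: "(\<lambda>n. lower_mass (\<mu> j) (v (r n)) (t (r n))) \<longlonglongrightarrow> lower_mass (\<mu> j) v0 t0"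
      by (rule tendsto_lower_mass[OF M[OF j] v0 vr tr])
    have "(\<lambda>n. \<epsilon> (r n) * t (r n)) \<longlonglongrightarrow> 0 * t0" by (intro tendsto_mult \<epsilon>r tr)
    \<comment> \<open>Only \<open>\<mu> 0\<close> is off balance, by the tilt; the other measures
      are bisected exactly.\<close>
    then have "(\<lambda>n. if j = 0 then \<epsilon> (r n) * t (r n) else 0) \<longlonglongrightarrow> 0"
      by (cases "j = 0") simp_all
    from tendsto_diff[OF tendsto_const this]
    have "(\<lambda>n. measure (\<mu> j) UNIV / 2 - (if j = 0 then \<epsilon> (r n) * t (r n) else 0))
        \<longlonglongrightarrow> measure (\<mu> j) UNIV / 2" by simp
    moreover have "lower_mass (\<mu> j) (v (r n)) (t (r n))
        = measure (\<mu> j) UNIV / 2 - (if j = 0 then \<epsilon> (r n) * t (r n) else 0)" for n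
    proof (cases "j = 0")
      case True
      have "v (r n) \<noteq> 0" using v(1)[of "r n"] by auto
      then show ?thesis using True tilted_median_balanced[OF M0 \<epsilon>(1)] by (simp add: t_def)
    next
      case False
      then show ?thesis using balanced[of j] j by (simp add: t_def)
    qed
    ultimately have "(\<lambda>n. lower_mass (\<mu> j) (v (r n)) (t (r n))) \<longlonglongrightarrow> measure (\<mu> j) UNIV / 2"
      by simp
    then show ?thesis using lim LIMSEQ_unique by blast
  qed
  then show ?thesis using equipartitions_hyperplane[OF M v0] by blast
qed

section \<open>Orthogonal equipartitions\<close>

lemma continuous_on_stiefel_component:
  fixes s :: "'a::topological_space \<Rightarrow> nat \<Rightarrow> real ^ 'n"
  assumes "continuous_map (top_of_set S) (stiefel_top k) s" "i < k"
  shows "continuous_on S (\<lambda>x. s x i)"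
proof -
  have "continuous_map (stiefel_top k) euclidean (\<lambda>v :: nat \<Rightarrow> real ^ 'n. v i)"
    unfolding stiefel_top_def using assms(2)
    by (intro continuous_map_from_subtopology continuous_map_product_projection) auto
  then have "continuous_map (top_of_set S) euclidean ((\<lambda>v. v i) \<circ> s)"
    using continuous_map_compose[OF assms(1)] by blast
  then show ?thesis by (simp add: comp_def)
qed

lemma continuous_on_lower_mass_tilted_median:
  fixes v :: "'a::metric_space \<Rightarrow> real ^ 'n"
  assumes M: "mass_distribution M" and M': "mass_distribution M'" and \<epsilon>: "\<epsilon> > 0"
    and v: "continuous_on S v" and nz: "\<And>x. x \<in> S \<Longrightarrow> v x \<noteq> 0"
  shows "continuous_on S (\<lambda>x. lower_mass M' (v x) (tilted_median M \<epsilon> (v x)))"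
proof -
  have t: "continuous_on S (\<lambda>x. tilted_median M \<epsilon> (v x))"
    using nz by (intro continuous_on_compose2[OF continuous_on_tilted_median[OF M \<epsilon>] v]) auto
  show ?thesis
    unfolding continuous_on_sequentially comp_def
  proof (intro allI ballI impI)
    fix x a assume a: "a \<in> S" "(\<forall>n. x n \<in> S) \<and> x \<longlonglongrightarrow> a"
    then have x: "x \<longlonglongrightarrow> a" "\<forall>\<^sub>F n in sequentially. x n \<in> S" by auto
    show "(\<lambda>n. lower_mass M' (v (x n)) (tilted_median M \<epsilon> (v (x n))))
        \<longlonglongrightarrow> lower_mass M' (v a) (tilted_median M \<epsilon> (v a))"
      by (rule tendsto_lower_mass[OF M' nz[OF a(1)]
            continuous_on_tendsto_compose[OF v x(1) a(1) x(2)]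
            continuous_on_tendsto_compose[OF t x(1) a(1) x(2)]])
  qed
qed

proposition has_bundle_section_imp_orthogonally_equipartitionable:
  assumes sec: "has_bundle_section TYPE('n::finite) r" "1 \<le> r"
    and k: "k \<le> r" "k * (m - 1) < CARD('n)" and m: "m \<ge> 1"
  shows "orthogonally_equipartitionable TYPE('n) m k"
  unfolding orthogonally_equipartitionable_def
proof (intro allI impI)
  fix \<mu> :: "nat \<Rightarrow> (real ^ 'n) measure"
  assume "\<forall>j<m. mass_distribution (\<mu> j)"
  then have M: "\<And>j. j < m \<Longrightarrow> mass_distribution (\<mu> j)" by blast
  then have M0: "mass_distribution (\<mu> 0)" using m by simp
  let ?S = "sphere 0 1 :: (real ^ 'n) set"
  obtain s :: "real ^ 'n \<Rightarrow> (nat \<Rightarrow> real ^ 'n)"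
    where s: "continuous_map (top_of_set ?S) (stiefel_top r) s"
      and odd: "\<And>x. x \<in> ?S \<Longrightarrow> s (- x) = neg_frame r (s x)"
    using sec has_bundle_section_iff_odd_map[OF sec(2), where ?'n = 'n] by blast
  have cont: "continuous_on ?S (\<lambda>x. s x i)" if "i < k" for i
    using continuous_on_stiefel_component[OF s] that k(1) by simp
  have "s x \<in> stiefel r" if "x \<in> ?S" for x
    using s that unfolding continuous_map_def topspace_stiefel_top by auto
  then have orthonormal: "s x i \<bullet> s x i' = (if i = i' then 1 else 0)"
    if "x \<in> ?S" "i < k" "i' < k" for x i i'
    using that k(1) by (auto simp: stiefel_def)
  then have norm: "norm (s x i) = 1" if "x \<in> ?S" "i < k" for x i
    using that by (simp add: norm_eq_1)
  then have nz: "s x i \<noteq> 0" if "x \<in> ?S" "i < k" for x i using norm[OF that] by auto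
  have s_minus: "s (- x) i = - s x i" if "x \<in> ?S" "i < k" for x i
    using odd[OF that(1)] that(2) k(1) by (simp add: neg_frame_def)
  have "\<exists>x\<in>?S. \<forall>i<k. \<forall>j. 1 \<le> j \<longrightarrow> j < m \<longrightarrow>
      lower_mass (\<mu> j) (s x i) (tilted_median (\<mu> 0) \<epsilon> (s x i)) = measure (\<mu> j) UNIV / 2"
    if \<epsilon>: "\<epsilon> > 0" for \<epsilon>
  proof -
    define F where "F i j x =
      lower_mass (\<mu> j) (s x i) (tilted_median (\<mu> 0) \<epsilon> (s x i)) - measure (\<mu> j) UNIV / 2" for i j x
    \<comment> \<open>The pairs \<open>(i, j)\<close> with \<open>i < k\<close> and \<open>1 \<le> j < m\<close> are encoded as \<open>l = i * (m - 1) + (j - 1)\<close>.\<close>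
    define f where "f l = F (l div (m - 1)) (Suc (l mod (m - 1)))" for l
    have index: "l div (m - 1) < k" "Suc (l mod (m - 1)) < m" if l: "l < k * (m - 1)" for l
    proof -
      have pos: "m - 1 > 0" using l by (cases "m - 1") auto
      show "l div (m - 1) < k" using l by (simp add: less_mult_imp_div_less)
      have "l mod (m - 1) < m - 1" using pos by (rule mod_less_divisor)
      then show "Suc (l mod (m - 1)) < m" by linarith
    qed
    \<comment> \<open>Each of the \<open>k\<close> normals gives \<open>m - 1\<close> defects. For
      \<open>m = 1\<close> there are none, and this merely provides a point of the sphere.\<close>
    have "\<exists>x\<in>?S. \<forall>l<k * (m - 1). f l x = 0"
    proof (rule borsuk_ulam)
      show "continuous_on ?S (f l)" if "l < k * (m - 1)" for l
        unfolding f_def F_def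
        using continuous_on_lower_mass_tilted_median
          [OF M0 M[OF index(2)[OF that]] \<epsilon> cont[OF index(1)[OF that]] nz[OF _ index(1)[OF that]]]
        by (intro continuous_on_diff continuous_on_const)
      \<comment> \<open>Passing to \<open>- x\<close> negates normal and median together, so the
        same hyperplane appears with its sides exchanged.\<close>
      show "f l (- x) = - f l x" if "l < k * (m - 1)" "x \<in> ?S" for l x
      proof -
        let ?v = "s x (l div (m - 1))" and ?M = "\<mu> (Suc (l mod (m - 1)))"
        have v: "?v \<noteq> 0" using nz that(2) index[OF that(1)] by blast
        show ?thesis
          unfolding f_def F_def s_minus[OF that(2) index(1)[OF that(1)]]
            tilted_median_minus[OF M0 \<epsilon> v] lower_mass_minus[OF M[OF index(2)[OF that(1)]] v]
          by simp
      qed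
      show "k * (m - 1) < DIM(real ^ 'n)" using k(2) by simp
    qed
    then obtain x where x: "x \<in> ?S" "\<And>l. l < k * (m - 1) \<Longrightarrow> f l x = 0" by blast
    have "F i j x = 0" if "i < k" "1 \<le> j" "j < m" for i j
    proof -
      define l where "l = i * (m - 1) + (j - 1)"
      have "j - 1 < m - 1" using that by linarith
      then have "l div (m - 1) = i" "l mod (m - 1) = j - 1" unfolding l_def by auto
      moreover have "l < k * (m - 1)"
      proof -
        have "l < Suc i * (m - 1)" using \<open>j - 1 < m - 1\<close> by (simp add: l_def)
        also have "\<dots> \<le> k * (m - 1)" using that(1) by (intro mult_le_mono1) simp
        finally show ?thesis .
      qed
      ultimately show ?thesis using x(2)[of l] that(2) by (simp add: f_def)
    qed
    then have "lower_mass (\<mu> j) (s x i) (tilted_median (\<mu> 0) \<epsilon> (s x i)) = measure (\<mu> j) UNIV / 2"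
      if "i < k" "1 \<le> j" "j < m" for i j
      using that unfolding F_def by simp
    then show ?thesis using x(1) by blast
  qed
  then have "\<exists>x\<in>?S. \<forall>i<k. \<forall>j. 1 \<le> j \<longrightarrow> j < m \<longrightarrow>
      lower_mass (\<mu> j) (s x i) (tilted_median (\<mu> 0) (inverse (real (Suc n))) (s x i))
        = measure (\<mu> j) UNIV / 2" for n
    by simp
  then obtain x where x: "\<And>n. x n \<in> ?S"
    and balanced: "\<And>n i j. i < k \<Longrightarrow> 1 \<le> j \<Longrightarrow> j < m \<Longrightarrow>
      lower_mass (\<mu> j) (s (x n) i) (tilted_median (\<mu> 0) (inverse (real (Suc n))) (s (x n) i))
        = measure (\<mu> j) UNIV / 2"
    by metis
  \<comment> \<open>One subsequence of points serves all \<open>i < k\<close>, so the limit normals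
    belong to the single frame \<open>s x0\<close> and are orthonormal; the offsets can then be
    found for each \<open>i\<close> separately.\<close>
  obtain x0 q where x0: "x0 \<in> ?S" and q: "strict_mono q" "(x \<circ> q) \<longlonglongrightarrow> x0"
    using compact_sphere[unfolded compact_def] x by metis
  have "\<exists>t. \<forall>j<m. equipartitions {y. s x0 i \<bullet> y = t} (\<mu> j)" if i: "i < k" for i
  proof (rule limit_of_tilted_bisectors[OF M m,
        where \<epsilon> = "\<lambda>n. inverse (real (Suc (q n)))" and v = "\<lambda>n. s (x (q n)) i"])
    show "(\<lambda>n. inverse (real (Suc (q n)))) \<longlonglongrightarrow> 0"
      using LIMSEQ_subseq_LIMSEQ[OF LIMSEQ_inverse_real_of_nat q(1)] by (simp add: comp_def)
    show "(\<lambda>n. s (x (q n)) i) \<longlonglongrightarrow> s x0 i"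
      using x q(2) by (intro continuous_on_tendsto_compose[OF cont[OF i] _ x0]) (auto simp: comp_def)
    show "norm (s (x (q n)) i) = 1" for n by (rule norm[OF x i])
    show "lower_mass (\<mu> j) (s (x (q n)) i)
        (tilted_median (\<mu> 0) (inverse (real (Suc (q n)))) (s (x (q n)) i)) = measure (\<mu> j) UNIV / 2"
      if "1 \<le> j" "j < m" for n j by (rule balanced[OF i that])
  qed simp_all
  then obtain t where t: "\<And>i j. i < k \<Longrightarrow> j < m \<Longrightarrow> equipartitions {y. s x0 i \<bullet> y = t i} (\<mu> j)"
    by metis
  define H where "H i = {y. s x0 i \<bullet> y = t i}" for i
  have normal: "normal_to (s x0 i) (H i)" if "i < k" for i
    using nz[OF x0 that] unfolding normal_to_def H_def by blast
  show "\<exists>H. (\<forall>i<k. hyperplane (H i)) \<and>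
      (\<forall>i<k. \<forall>i'<k. i \<noteq> i' \<longrightarrow> orthogonal_hyperplanes (H i) (H i')) \<and>
      (\<forall>i<k. \<forall>j<m. equipartitions (H i) (\<mu> j))"
  proof (intro exI[of _ H] conjI allI impI)
    show "hyperplane (H i)" if "i < k" for i using normal[OF that] unfolding hyperplane_def by blast
    show "orthogonal_hyperplanes (H i) (H i')" if "i < k" "i' < k" "i \<noteq> i'" for i i'
      unfolding orthogonal_hyperplanes_def orthogonal_def
      using normal[OF that(1)] normal[OF that(2)] orthonormal[OF x0 that(1,2)] that(3) by auto
    show "equipartitions (H i) (\<mu> j)" if "i < k" "j < m" for i j
      unfolding H_def by (rule t[OF that])
  qed
qed

theorem theorem2p1:
  fixes m :: nat
  assumes "m \<ge> 1"
  shows "Omega_perp TYPE('n::finite) m \<ge>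
    (if m = 1 then rho TYPE('n) else min (rho TYPE('n)) ((CARD('n) - 1) div (m - 1)))"
proof -
  define k where "k = (if m = 1 then rho TYPE('n)
    else min (rho TYPE('n)) ((CARD('n) - 1) div (m - 1)))"
  \<comment> \<open>The number of defects has to stay below the dimension. The floor ensures this,
    and for \<open>m = 1\<close> the product is 0.\<close>
  have "k * (m - 1) \<le> CARD('n) - 1"
  proof (cases "m = 1")
    case False
    then have "k * (m - 1) \<le> (CARD('n) - 1) div (m - 1) * (m - 1)"
      unfolding k_def by (intro mult_le_mono1) simp
    then show ?thesis using div_times_less_eq_dividend order_trans by blast
  qed simp
  moreover have "CARD('n) > 0" by simp
  ultimately have "k * (m - 1) < CARD('n)" by linarith
  moreover have "k \<le> rho TYPE('n)" unfolding k_def by simp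
  ultimately have "orthogonally_equipartitionable TYPE('n) m k"
    using rho_attained(2)[where 'n = 'n] assms by (intro has_bundle_section_imp_orthogonally_equipartitionable) auto
  then show ?thesis
    unfolding k_def[symmetric] Omega_perp_def by (intro Max_ge Omega_perp_attained(1)) simp
qed

end
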